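(* Let $(E,\mathcal{P})$ be a random locally convex module over $\mathbb{R}$ with base $(\Omega,\mathcal{F},P)$, and let $M$ and $G$ be two nonempty $L^{0}$-convex subsets of $E$ such that $G$ is $\mathcal{T}_c$-open and $\mathcal{C}_{cc}(G)\cap\mathcal{C}_{cc}(M)=\emptyset$. Then there exists $f\in E^{*}_{c}$ such that $$f(x)<f(y)\ \text{ on } H(M,G)\ \text{ for all } x\in G \text{ and } y\in M,$$ and $$f(x)<f(y)\ \text{ for all } x\in G \text{ and } y\in M.$$ If $\mathbb{R}$ is replaced by $\mathbb{C}$, the result still holds in the following form: there exists $f\in E_c^*$ such that $$(\mathrm{Re} f)(x)<(\mathrm{Re} f)(y)\ \text{ on } H(M,G)\ \text{ for all } x\in G \text{ and } y\in M,$$ and $$(\mathrm{Re} f)(x)<(\mathrm{Re} f)(y)\ \text{ for all } x\in G \text{ and } y\in M.$$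
   Context: $(\Omega,\mathcal{F},P)$ is a probability space, $K=\mathbb{R}$ or $\mathbb{C}$, and $L^{0}(\mathcal{F},K)$ is the algebra of equivalence classes (under a.s. equality) of $K$-valued $\mathcal{F}$-measurable functions; $L^0(\mathcal F,\mathbb R)$ has a.s. pointwise order and $\vee$ denotes lattice supremum. $\xi<\eta$ means $\xi\le\eta$ and $\xi\ne\eta$; "$\xi<\eta$ on $A$" ($A\in\mathcal F$) means that representatives satisfy $\xi^0(\omega)<\eta^0(\omega)$ for almost all $\omega\in A$. $L^0_+=\{\xi\in L^0(\mathcal F,\mathbb R):\xi\ge 0\}$; $L^0_{++}$ is the set of $\xi\in L^0_+$ with $\xi>0$ a.s. on $\Omega$. $\tilde I_A$ is the class of the indicator of $A\in\mathcal F$, and $\tilde I_AG=\{\tilde I_Ax:x\in G\}$. An $L^0$-seminorm on a left $L^{0}(\mathcal{F},K)$-module $E$ is a map $\|\cdot\|:E\to L^0_+$ with $\|\xi x\|=|\xi|\,\|x\|$ and $\|x+y\|\le\|x\|+\|y\|$ for all $\xi\in L^0(\mathcal F,K)$, $x,y\in E$. A random locally convex module over $K$ with base $(\Omega,\mathcal F,P)$ is a pair $(E,\mathcal P)$ of a left $L^0(\mathcal F,K)$-module $E$ and a family $\mathcal P$ of $L^0$-seminorms on $E$ such that $\vee\{\|x\|:\|\cdot\|\in\mathcal P\}=0$ iff $x=\theta$ (null element). For finite $Q\subset\mathcal P$ put $\|x\|_Q=\vee\{\|x\|:\|\cdot\|\in Q\}$. $\mathcal T_c$ is the topology on $E$ in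 which $G\subset E$ is open iff for every $x\in G$ there are a finite $Q\subset\mathcal P$ and $\varepsilon\in L^0_{++}$ with $x+\{y:\|y\|_Q\le\varepsilon\}\subset G$; $L^0(\mathcal F,K)$ carries the $\mathcal T_c$ induced by $|\cdot|$. $E^*_c$ is the set of continuous module homomorphisms from $(E,\mathcal T_c)$ to $(L^0(\mathcal F,K),\mathcal T_c)$. $(\mathrm{Re}f)(x)=\mathrm{Re}(f(x))$. $G\subset E$ is $L^0$-convex if $\xi x+(1-\xi)y\in G$ for all $x,y\in G$ and $\xi\in L^0_+$ with $0\le\xi\le1$. A countable concatenation is a formal sum $\sum_{n\ge1}\tilde I_{A_n}x_n$, with $\{A_n\}$ a countable partition of $\Omega$ into members of $\mathcal F$ and $\{x_n\}$ a sequence in $E$; two formal sums $\sum_n\tilde I_{A_n}x_n$ and $\sum_n\tilde I_{B_n}y_n$ are identified if $\tilde I_{A_i\cap B_j}x_i=\tilde I_{A_i\cap B_j}y_j$ for all $i,j$. $\mathcal C_{cc}(G)$ is the set of all such formal countable concatenations with every $x_n\in G$. The hereditarily disjoint stratification of $M$ and $G$ is the set (unique a.s.) $H(M,G)=\Omega\setminus\operatorname{ess\,sup}\{A\in\mathcal F:\tilde I_AM\cap\tilde I_AG\neq\emptyset\}$, where $\operatorname{ess\,sup}$ is the essential supremum of a family of measurable sets. *)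

theory Defs
  imports "HOL-Algebra.Module" "HOL-Algebra.Lattice" "HOL-Probability.Probability"
begin

section \<open>The algebra of classes of random variables\<close>

text \<open>An element of \<open>L\<^sup>0\<close> is an honest equivalence class: a set of measurable functions. The operations
  are choice-free: \<open>L0_map P h X\<close> is the class of \<open>h \<circ> f\<close> for any representative \<open>f\<close> of \<open>X\<close>.\<close>

definition L0_class :: "'w measure \<Rightarrow> ('w \<Rightarrow> 'k::topological_space) \<Rightarrow> ('w \<Rightarrow> 'k) set" where
  "L0_class P f = {g \<in> borel_measurable P. AE w in P. g w = f w}"

definition L0_map ::
    "'w measure \<Rightarrow> ('j \<Rightarrow> 'k::topological_space) \<Rightarrow> ('w \<Rightarrow> 'j) set \<Rightarrow> ('w \<Rightarrow> 'k) set" where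
  "L0_map P h X = {g \<in> borel_measurable P. \<exists>f\<in>X. AE w in P. g w = h (f w)}"

definition L0_map2 ::
    "'w measure \<Rightarrow> ('i \<Rightarrow> 'j \<Rightarrow> 'k::topological_space)
      \<Rightarrow> ('w \<Rightarrow> 'i) set \<Rightarrow> ('w \<Rightarrow> 'j) set \<Rightarrow> ('w \<Rightarrow> 'k) set" where
  "L0_map2 P h X Y =
     {g \<in> borel_measurable P. \<exists>f1\<in>X. \<exists>f2\<in>Y. AE w in P. g w = h (f1 w) (f2 w)}"

text \<open>The record is of \<open>module\<close> type, so that \<open>L0 P\<close> serves both as the scalar ring and as a module
  over itself. The scalar field is \<open>'k = real\<close> or \<open>'k = complex\<close>.\<close>

definition L0 :: "'w measure
    \<Rightarrow> (('w \<Rightarrow> 'k) set, ('w \<Rightarrow> 'k::{real_normed_field, second_countable_topology}) set) module" where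
  "L0 P = \<lparr>carrier = L0_class P ` borel_measurable P,
           monoid.mult = L0_map2 P (*),
           one = L0_class P (\<lambda>_. 1),
           zero = L0_class P (\<lambda>_. 0),
           add = L0_map2 P (+),
           module.smult = L0_map2 P (*)\<rparr>"

abbreviation L0_abs :: "'w measure \<Rightarrow> ('w \<Rightarrow> 'k::real_normed_vector) set \<Rightarrow> ('w \<Rightarrow> real) set" where
  "L0_abs P \<equiv> L0_map P norm"

abbreviation L0_of_real ::
    "'w measure \<Rightarrow> ('w \<Rightarrow> real) set \<Rightarrow> ('w \<Rightarrow> 'k::{real_normed_field, second_countable_topology}) set" where
  "L0_of_real P \<equiv> L0_map P of_real"

abbreviation L0_Re :: "'w measure \<Rightarrow> ('w \<Rightarrow> complex) set \<Rightarrow> ('w \<Rightarrow> real) set" where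
  "L0_Re P \<equiv> L0_map P Re"

abbreviation L0_ind ::
    "'w measure \<Rightarrow> 'w set \<Rightarrow> ('w \<Rightarrow> 'k::{real_normed_field, second_countable_topology}) set" where
  "L0_ind P A \<equiv> L0_class P (indicator A)"

definition L0_le :: "'w measure \<Rightarrow> ('w \<Rightarrow> real) set \<Rightarrow> ('w \<Rightarrow> real) set \<Rightarrow> bool" where
  "L0_le P X Y \<longleftrightarrow> (\<exists>f\<in>X. \<exists>g\<in>Y. AE w in P. f w \<le> g w)"

definition L0_less :: "'w measure \<Rightarrow> ('w \<Rightarrow> real) set \<Rightarrow> ('w \<Rightarrow> real) set \<Rightarrow> bool" where
  "L0_less P X Y \<longleftrightarrow> L0_le P X Y \<and> X \<noteq> Y"

definition L0_less_on ::
    "'w measure \<Rightarrow> 'w set \<Rightarrow> ('w \<Rightarrow> real) set \<Rightarrow> ('w \<Rightarrow> real) set \<Rightarrow> bool" where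
  "L0_less_on P A X Y \<longleftrightarrow> (\<exists>f\<in>X. \<exists>g\<in>Y. AE w in P. w \<in> A \<longrightarrow> f w < g w)"

definition L0_plus :: "'w measure \<Rightarrow> ('w \<Rightarrow> real) set gorder" where
  "L0_plus P = \<lparr>carrier = {X \<in> carrier (L0 P). L0_le P \<zero>\<^bsub>L0 P\<^esub> X}, eq = (=), le = L0_le P\<rparr>"

definition L0_pplus :: "'w measure \<Rightarrow> ('w \<Rightarrow> real) set set" where
  "L0_pplus P = {X \<in> carrier (L0_plus P). L0_less_on P (space P) \<zero>\<^bsub>L0 P\<^esub> X}"


section \<open>Random locally convex modules\<close>

definition L0_seminorm :: "'w measure
    \<Rightarrow> (('w \<Rightarrow> 'k::{real_normed_field, second_countable_topology}) set, 'e, 'm) module_scheme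
    \<Rightarrow> ('e \<Rightarrow> ('w \<Rightarrow> real) set) \<Rightarrow> bool" where
  "L0_seminorm P E n \<longleftrightarrow>
     n \<in> carrier E \<rightarrow> carrier (L0_plus P) \<and>
     (\<forall>\<xi>\<in>carrier (L0 P). \<forall>x\<in>carrier E. n (\<xi> \<odot>\<^bsub>E\<^esub> x) = L0_abs P \<xi> \<otimes>\<^bsub>L0 P\<^esub> n x) \<and>
     (\<forall>x\<in>carrier E. \<forall>y\<in>carrier E. L0_le P (n (x \<oplus>\<^bsub>E\<^esub> y)) (n x \<oplus>\<^bsub>L0 P\<^esub> n y))"

text \<open>The supremum over the possibly infinite family \<open>\<N>\<close> need not exist in \<open>L\<^sup>0\<close>; \<open>separating\<close>
  therefore says that \<open>0\<close> is the least upper bound of \<open>{n x | n \<in> \<N>}\<close>, rather than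
  equating \<open>0\<close> with a term for the supremum. Suprema are formed in \<open>L\<^sup>0\<^sub>+\<close>, which only
  matters for the empty family, whose supremum is thereby \<open>0\<close>.\<close>

locale random_lc_module = prob_space P + Module.module "L0 P" E
  for P :: "'w measure"
    and E :: "(('w \<Rightarrow> 'k::{real_normed_field, second_countable_topology}) set, 'e, 'm) module_scheme" +
  fixes \<N> :: "('e \<Rightarrow> ('w \<Rightarrow> real) set) set"
  assumes seminorm: "n \<in> \<N> \<Longrightarrow> L0_seminorm P E n"
    and separating: "x \<in> carrier E \<Longrightarrow>
      is_lub (L0_plus P) \<zero>\<^bsub>L0 P\<^esub> ((\<lambda>n. n x) ` \<N>) \<longleftrightarrow> x = \<zero>\<^bsub>E\<^esub>"

definition seminorm_sup ::
    "'w measure \<Rightarrow> ('e \<Rightarrow> ('w \<Rightarrow> real) set) set \<Rightarrow> 'e \<Rightarrow> ('w \<Rightarrow> real) set" where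
  "seminorm_sup P Q x = Lattice.sup (L0_plus P) ((\<lambda>n. n x) ` Q)"

definition Tc_open :: "'w measure \<Rightarrow> ('a, 'e, 'm) module_scheme
    \<Rightarrow> ('e \<Rightarrow> ('w \<Rightarrow> real) set) set \<Rightarrow> 'e set \<Rightarrow> bool" where
  "Tc_open P E \<N> G \<longleftrightarrow> G \<subseteq> carrier E \<and>
     (\<forall>x\<in>G. \<exists>Q \<epsilon>. finite Q \<and> Q \<subseteq> \<N> \<and> \<epsilon> \<in> L0_pplus P \<and>
        {x \<oplus>\<^bsub>E\<^esub> y | y. y \<in> carrier E \<and> L0_le P (seminorm_sup P Q y) \<epsilon>} \<subseteq> G)"

definition Tc :: "'w measure \<Rightarrow> ('a, 'e, 'm) module_scheme
    \<Rightarrow> ('e \<Rightarrow> ('w \<Rightarrow> real) set) set \<Rightarrow> 'e topology" where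
  "Tc P E \<N> = topology (Tc_open P E \<N>)"

definition Tc_dual :: "'w measure
    \<Rightarrow> (('w \<Rightarrow> 'k::{real_normed_field, second_countable_topology}) set, 'e, 'm) module_scheme
    \<Rightarrow> ('e \<Rightarrow> ('w \<Rightarrow> real) set) set \<Rightarrow> ('e \<Rightarrow> ('w \<Rightarrow> 'k) set) set" where
  "Tc_dual P E \<N> = {f \<in> carrier E \<rightarrow> carrier (L0 P).
     (\<forall>x\<in>carrier E. \<forall>y\<in>carrier E. f (x \<oplus>\<^bsub>E\<^esub> y) = f x \<oplus>\<^bsub>L0 P\<^esub> f y) \<and>
     (\<forall>\<xi>\<in>carrier (L0 P). \<forall>x\<in>carrier E. f (\<xi> \<odot>\<^bsub>E\<^esub> x) = \<xi> \<odot>\<^bsub>L0 P\<^esub> f x) \<and>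
     continuous_map (Tc P E \<N>) (Tc P (L0 P :: (_, ('w \<Rightarrow> 'k) set) module) {L0_abs P}) f}"

definition L0_convex :: "'w measure
    \<Rightarrow> (('w \<Rightarrow> 'k::{real_normed_field, second_countable_topology}) set, 'e, 'm) module_scheme
    \<Rightarrow> 'e set \<Rightarrow> bool" where
  "L0_convex P E G \<longleftrightarrow> G \<subseteq> carrier E \<and>
     (\<forall>x\<in>G. \<forall>y\<in>G. \<forall>\<xi>\<in>carrier (L0_plus P). L0_le P \<xi> \<one>\<^bsub>L0 P\<^esub> \<longrightarrow>
        L0_of_real P \<xi> \<odot>\<^bsub>E\<^esub> x \<oplus>\<^bsub>E\<^esub> L0_of_real P (\<one>\<^bsub>L0 P\<^esub> \<ominus>\<^bsub>L0 P\<^esub> \<xi>) \<odot>\<^bsub>E\<^esub> y \<in> G)"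


section \<open>Countable concatenations and stratification\<close>

text \<open>A formal sum is the pair of its sequences \<open>(A, x)\<close>. Members of the partition may be empty, so
  finite partitions are included. Elements of \<open>Ccc P E G\<close> are classes of formal sums.\<close>

definition formal_sums :: "'w measure \<Rightarrow> ('a, 'e, 'm) module_scheme
    \<Rightarrow> ((nat \<Rightarrow> 'w set) \<times> (nat \<Rightarrow> 'e)) set" where
  "formal_sums P E = {(A, x). range A \<subseteq> sets P \<and> disjoint_family A \<and> (\<Union>n. A n) = space P \<and>
     range x \<subseteq> carrier E}"

definition formal_sum_rel :: "'w measure
    \<Rightarrow> (('w \<Rightarrow> 'k::{real_normed_field, second_countable_topology}) set, 'e, 'm) module_scheme
    \<Rightarrow> ((nat \<Rightarrow> 'w set) \<times> (nat \<Rightarrow> 'e)) rel" where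
  "formal_sum_rel P E = {((A, x), (B, y)).
     (A, x) \<in> formal_sums P E \<and> (B, y) \<in> formal_sums P E \<and>
     (\<forall>i j. L0_ind P (A i \<inter> B j) \<odot>\<^bsub>E\<^esub> x i = L0_ind P (A i \<inter> B j) \<odot>\<^bsub>E\<^esub> y j)}"

definition Ccc :: "'w measure
    \<Rightarrow> (('w \<Rightarrow> 'k::{real_normed_field, second_countable_topology}) set, 'e, 'm) module_scheme
    \<Rightarrow> 'e set \<Rightarrow> ((nat \<Rightarrow> 'w set) \<times> (nat \<Rightarrow> 'e)) set set" where
  "Ccc P E G = {(A, x) \<in> formal_sums P E. range x \<subseteq> G} // formal_sum_rel P E"

text \<open>The essential supremum of a family of measurable sets is determined only up to null sets;
  \<open>ess_sup_sets\<close> picks one version.\<close>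

definition is_ess_sup_sets :: "'w measure \<Rightarrow> 'w set set \<Rightarrow> 'w set \<Rightarrow> bool" where
  "is_ess_sup_sets P \<A> S \<longleftrightarrow> S \<in> sets P \<and>
     (\<forall>A\<in>\<A>. AE w in P. w \<in> A \<longrightarrow> w \<in> S) \<and>
     (\<forall>T\<in>sets P. (\<forall>A\<in>\<A>. AE w in P. w \<in> A \<longrightarrow> w \<in> T) \<longrightarrow> (AE w in P. w \<in> S \<longrightarrow> w \<in> T))"

definition ess_sup_sets :: "'w measure \<Rightarrow> 'w set set \<Rightarrow> 'w set" where
  "ess_sup_sets P \<A> = (SOME S. is_ess_sup_sets P \<A> S)"

definition hd_stratification :: "'w measure
    \<Rightarrow> (('w \<Rightarrow> 'k::{real_normed_field, second_countable_topology}) set, 'e, 'm) module_scheme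
    \<Rightarrow> 'e set \<Rightarrow> 'e set \<Rightarrow> 'w set" where
  "hd_stratification P E M G = space P - ess_sup_sets P
     {A \<in> sets P. (\<lambda>x. L0_ind P A \<odot>\<^bsub>E\<^esub> x) ` M \<inter> (\<lambda>x. L0_ind P A \<odot>\<^bsub>E\<^esub> x) ` G \<noteq> {}}"


section \<open>The definitions are meaningful\<close>

text \<open>\<open>L\<^sup>0\<close> is a commutative ring and a random locally convex module over itself; the \<open>\<T>\<^sub>c\<close>-open
  sets form a topology, so \<open>Tc\<close> does not appeal to an unspecified value of \<open>topology\<close>; and
  essential suprema of families of events exist, so neither does the choice in \<open>ess_sup_sets\<close>.\<close>

lemma L0_class_eq:
  assumes "f \<in> borel_measurable P" "g \<in> borel_measurable P" 
  shows "L0_class P f = L0_class P g \<longleftrightarrow> (AE w in P. f w = g w)"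
proof
  assume "L0_class P f = L0_class P g"
  moreover have "f \<in> L0_class P f" using assms by (auto simp: L0_class_def)
  ultimately show "AE w in P. f w = g w" by (auto simp: L0_class_def)
next
  assume a: "AE w in P. f w = g w"
  have "AE w in P. h w = f w \<longleftrightarrow> h w = g w" for h using a by (rule AE_mp) simp
  then have "(AE w in P. h w = f w) \<longleftrightarrow> (AE w in P. h w = g w)" for h
    using eventually_subst by blast
  then show "L0_class P f = L0_class P g" by (auto simp: L0_class_def)
qed

lemma L0_map_class:
  assumes "f \<in> borel_measurable P"
  shows "L0_map P h (L0_class P f) = L0_class P (\<lambda>w. h (f w))"
proof -
  have "AE w in P. g w = h (f w)" if "AE w in P. f' w = f w" "AE w in P. g w = h (f' w)" for g f'
    using that by eventually_elim simp
  then show ?thesis using assms by (force simp: L0_map_def L0_class_def)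
qed

lemma L0_map2_class:
  assumes "f \<in> borel_measurable P" "g \<in> borel_measurable P"
  shows "L0_map2 P h (L0_class P f) (L0_class P g) = L0_class P (\<lambda>w. h (f w) (g w))"
proof -
  have *: "AE w in P. k w = h (f w) (g w)"
    if "AE w in P. f' w = f w" "AE w in P. g' w = g w" "AE w in P. k w = h (f' w) (g' w)" for k f' g'
    using that by eventually_elim simp
  have "f \<in> L0_class P f" "g \<in> L0_class P g" using assms by (auto simp: L0_class_def)
  then show ?thesis by (auto simp: L0_map2_def L0_class_def intro: *)
qed

lemma L0_le_class:
  assumes "f \<in> borel_measurable P" "g \<in> borel_measurable P"
  shows "L0_le P (L0_class P f) (L0_class P g) \<longleftrightarrow> (AE w in P. f w \<le> g w)"
proof -
  have *: "AE w in P. f w \<le> g w"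
    if "AE w in P. f' w = f w" "AE w in P. g' w = g w" "AE w in P. f' w \<le> g' w" for f' g'
    using that by eventually_elim simp
  have "f \<in> L0_class P f" "g \<in> L0_class P g" using assms by (auto simp: L0_class_def)
  then show ?thesis by (auto simp: L0_le_def L0_class_def intro: *)
qed

lemma L0_less_on_class:
  assumes "f \<in> borel_measurable P" "g \<in> borel_measurable P"
  shows "L0_less_on P A (L0_class P f) (L0_class P g) \<longleftrightarrow> (AE w in P. w \<in> A \<longrightarrow> f w < g w)"
proof -
  have *: "AE w in P. w \<in> A \<longrightarrow> f w < g w"
    if "AE w in P. f' w = f w" "AE w in P. g' w = g w" "AE w in P. w \<in> A \<longrightarrow> f' w < g' w" for f' g'
    using that by eventually_elim simp
  have "f \<in> L0_class P f" "g \<in> L0_class P g" using assms by (auto simp: L0_class_def)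
  then show ?thesis by (auto simp: L0_less_on_def L0_class_def intro: *)
qed

lemma L0_cring: "cring (L0 P :: (_, ('w \<Rightarrow> 'k::{real_normed_field, second_countable_topology}) set) module)"
proof (rule cringI)
  let ?R = "L0 P :: (_, ('w \<Rightarrow> 'k) set) module"
  show "abelian_group ?R"
  proof (rule abelian_groupI)
    fix x assume "x \<in> carrier ?R"
    then obtain f where f: "f \<in> borel_measurable P" "x = L0_class P f" by (auto simp: L0_def)
    then have "L0_class P (\<lambda>w. - f w) \<in> carrier ?R" by (auto simp: L0_def)
    moreover have "L0_class P (\<lambda>w. - f w) \<oplus>\<^bsub>?R\<^esub> x = \<zero>\<^bsub>?R\<^esub>"
      using f by (simp add: L0_def L0_map2_class)
    ultimately show "\<exists>y\<in>carrier ?R. y \<oplus>\<^bsub>?R\<^esub> x = \<zero>\<^bsub>?R\<^esub>" by blast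
  qed (auto simp: L0_def L0_map2_class ac_simps)
  show "comm_monoid ?R"
    by (rule comm_monoidI) (auto simp: L0_def L0_map2_class ac_simps)
qed (auto simp: L0_def L0_map2_class algebra_simps)

lemma L0_module_self:
  "Module.module (L0 P :: (_, ('w \<Rightarrow> 'k::{real_normed_field, second_countable_topology}) set) module)
     (L0 P :: (_, ('w \<Rightarrow> 'k) set) module)"
proof (rule moduleI)
  show "cring (L0 P :: (_, ('w \<Rightarrow> 'k) set) module)" by (rule L0_cring)
  then interpret cring "L0 P :: (_, ('w \<Rightarrow> 'k) set) module" .
  show "abelian_group (L0 P :: (_, ('w \<Rightarrow> 'k) set) module)" by unfold_locales
qed (auto simp: L0_def L0_map2_class algebra_simps)

lemma L0_plus_lattice: "Lattice.lattice (L0_plus P)"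
proof -
  have rep: "\<exists>f\<in>borel_measurable P. X = L0_class P f \<and> (AE w in P. 0 \<le> f w)"
    if "X \<in> carrier (L0_plus P)" for X
    using that by (auto simp: L0_plus_def L0_def L0_le_class)
  have inC: "L0_class P f \<in> carrier (L0_plus P)"
    if "f \<in> borel_measurable P" "AE w in P. 0 \<le> f w" for f
    using that by (auto simp: L0_plus_def L0_def L0_le_class)
  interpret po: partial_order "L0_plus P"
  proof
    fix x y z assume "x \<in> carrier (L0_plus P)" "y \<in> carrier (L0_plus P)" "z \<in> carrier (L0_plus P)"
      and le: "x \<sqsubseteq>\<^bsub>L0_plus P\<^esub> y" "y \<sqsubseteq>\<^bsub>L0_plus P\<^esub> z"
    then obtain f g h where fgh: "f \<in> borel_measurable P" "g \<in> borel_measurable P"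
      "h \<in> borel_measurable P" "x = L0_class P f" "y = L0_class P g" "z = L0_class P h"
      by (metis rep)
    have "AE w in P. f w \<le> g w" "AE w in P. g w \<le> h w"
      using le fgh by (auto simp: L0_plus_def L0_le_class)
    then have "AE w in P. f w \<le> h w" by eventually_elim simp
    then show "x \<sqsubseteq>\<^bsub>L0_plus P\<^esub> z" using fgh by (simp add: L0_plus_def L0_le_class)
  next
    fix x y assume "x \<in> carrier (L0_plus P)" "y \<in> carrier (L0_plus P)"
      and le: "x \<sqsubseteq>\<^bsub>L0_plus P\<^esub> y" "y \<sqsubseteq>\<^bsub>L0_plus P\<^esub> x"
    then obtain f g where fg: "f \<in> borel_measurable P" "g \<in> borel_measurable P"
      "x = L0_class P f" "y = L0_class P g" by (metis rep)
    have "AE w in P. f w \<le> g w" "AE w in P. g w \<le> f w" using le fg by (auto simp: L0_plus_def L0_le_class)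
    then have "AE w in P. f w = g w" by eventually_elim simp
    then show "x .=\<^bsub>L0_plus P\<^esub> y" using fg by (simp add: L0_plus_def L0_class_eq)
  next
    fix x assume "x \<in> carrier (L0_plus P)"
    then obtain f where "f \<in> borel_measurable P" "x = L0_class P f" by (metis rep)
    then show "x \<sqsubseteq>\<^bsub>L0_plus P\<^esub> x" by (simp add: L0_plus_def L0_le_class)
  qed (auto simp: L0_plus_def)
  have le_iff: "L0_class P f \<sqsubseteq>\<^bsub>L0_plus P\<^esub> L0_class P g \<longleftrightarrow> (AE w in P. f w \<le> g w)"
    if "f \<in> borel_measurable P" "g \<in> borel_measurable P" for f g
    using that by (simp add: L0_plus_def L0_le_class)
  show ?thesis
  proof
    fix x y assume xy: "x \<in> carrier (L0_plus P)" "y \<in> carrier (L0_plus P)"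
    then obtain f g where fg: "f \<in> borel_measurable P" "g \<in> borel_measurable P"
      "x = L0_class P f" "y = L0_class P g" "AE w in P. 0 \<le> f w" "AE w in P. 0 \<le> g w" by (metis rep)
    have m: "(\<lambda>w. max (f w) (g w)) \<in> borel_measurable P" "(\<lambda>w. min (f w) (g w)) \<in> borel_measurable P"
      using fg by measurable
    have "AE w in P. 0 \<le> max (f w) (g w)" "AE w in P. 0 \<le> min (f w) (g w)"
      using fg(5,6) by (eventually_elim, simp)+
    note c = inC[OF m(1) this(1)] inC[OF m(2) this(2)]
    have "least (L0_plus P) (L0_class P (\<lambda>w. max (f w) (g w))) (Upper (L0_plus P) {x, y})"
    proof (rule least_UpperI)
      fix u assume u: "u \<in> Upper (L0_plus P) {x, y}"
      then have "u \<in> carrier (L0_plus P)" by (simp add: Upper_def)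
      then obtain h where h: "h \<in> borel_measurable P" "u = L0_class P h" by (metis rep)
      have "x \<sqsubseteq>\<^bsub>L0_plus P\<^esub> u" "y \<sqsubseteq>\<^bsub>L0_plus P\<^esub> u"
        using u xy by (auto simp: Upper_def)
      then have "AE w in P. f w \<le> h w" "AE w in P. g w \<le> h w" using fg h by (simp_all add: le_iff)
      then have "AE w in P. max (f w) (g w) \<le> h w" by eventually_elim simp
      then show "L0_class P (\<lambda>w. max (f w) (g w)) \<sqsubseteq>\<^bsub>L0_plus P\<^esub> u"
        using h m by (simp add: le_iff)
    qed (use fg(1-4) m c xy in \<open>auto simp: le_iff\<close>)
    then show "\<exists>s. least (L0_plus P) s (Upper (L0_plus P) {x, y})" by blast
    have "greatest (L0_plus P) (L0_class P (\<lambda>w. min (f w) (g w))) (Lower (L0_plus P) {x, y})"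
    proof (rule greatest_LowerI)
      fix u assume u: "u \<in> Lower (L0_plus P) {x, y}"
      then have "u \<in> carrier (L0_plus P)" by (simp add: Lower_def)
      then obtain h where h: "h \<in> borel_measurable P" "u = L0_class P h" by (metis rep)
      have "u \<sqsubseteq>\<^bsub>L0_plus P\<^esub> x" "u \<sqsubseteq>\<^bsub>L0_plus P\<^esub> y"
        using u xy by (auto simp: Lower_def)
      then have "AE w in P. h w \<le> f w" "AE w in P. h w \<le> g w" using fg h by (simp_all add: le_iff)
      then have "AE w in P. h w \<le> min (f w) (g w)" by eventually_elim simp
      then show "u \<sqsubseteq>\<^bsub>L0_plus P\<^esub> L0_class P (\<lambda>w. min (f w) (g w))"
        using h m by (simp add: le_iff)
    qed (use fg(1-4) m c xy in \<open>auto simp: le_iff\<close>)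
    then show "\<exists>s. greatest (L0_plus P) s (Lower (L0_plus P) {x, y})" by blast
  qed
qed

lemma L0_sup_le_iff:
  assumes "finite \<X>" "\<X> \<subseteq> carrier (L0_plus P)" "\<epsilon> \<in> carrier (L0_plus P)"
  shows "L0_le P (Lattice.sup (L0_plus P) \<X>) \<epsilon> \<longleftrightarrow> (\<forall>X\<in>\<X>. L0_le P X \<epsilon>)"
proof -
  interpret Lattice.lattice "L0_plus P" by (rule L0_plus_lattice)
  have le: "le (L0_plus P) = L0_le P" by (simp add: L0_plus_def)
  have least: "least (L0_plus P) (Lattice.sup (L0_plus P) \<X>) (Upper (L0_plus P) \<X>)"
  proof (cases "\<X> = {}")
    case True
    have "L0_class P (\<lambda>_. 0) \<in> carrier (L0_plus P)" by (auto simp: L0_plus_def L0_def L0_le_class)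
    then have "least (L0_plus P) (L0_class P (\<lambda>_. 0)) (Upper (L0_plus P) {})"
      by (auto simp: least_def Upper_def le) (auto simp: L0_plus_def L0_def)
    then show ?thesis unfolding True Lattice.sup_def by (rule someI)
  qed (use assms finite_sup_least in auto)
  then have "Lattice.sup (L0_plus P) \<X> \<in> carrier (L0_plus P)" by (auto simp: least_def Upper_def)
  then show ?thesis
    using least assms le_trans[unfolded le]
    unfolding least_def Upper_def le by (smt (verit) IntE IntI mem_Collect_eq subsetD)
qed

lemma L0_pplus_min:
  assumes "\<epsilon> \<in> L0_pplus P" "\<delta> \<in> L0_pplus P"
  obtains \<gamma> where "\<gamma> \<in> L0_pplus P" "\<And>X. X \<in> carrier (L0 P) \<Longrightarrow> L0_le P X \<gamma> \<Longrightarrow> L0_le P X \<epsilon> \<and> L0_le P X \<delta>"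
proof -
  obtain f g where fg: "f \<in> borel_measurable P" "g \<in> borel_measurable P" 
    "\<epsilon> = L0_class P f" "\<delta> = L0_class P g" using assms by (auto simp: L0_pplus_def L0_plus_def L0_def)
  have pos: "AE w in P. 0 < f w" "AE w in P. 0 < g w"
    using assms fg by (auto simp: L0_pplus_def L0_def L0_less_on_class)
  show thesis
  proof
    have m: "(\<lambda>w. min (f w) (g w)) \<in> borel_measurable P" using fg by measurable
    have p: "AE w in P. 0 < min (f w) (g w)" using pos by eventually_elim simp
    then have "AE w in P. 0 \<le> min (f w) (g w)" by eventually_elim simp
    with m p show "L0_class P (\<lambda>w. min (f w) (g w)) \<in> L0_pplus P"
      by (auto simp: L0_pplus_def L0_plus_def L0_def L0_le_class L0_less_on_class)
    fix X assume "X \<in> carrier (L0 P)" "L0_le P X (L0_class P (\<lambda>w. min (f w) (g w)))"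
    then show "L0_le P X \<epsilon> \<and> L0_le P X \<delta>"
      using fg m by (auto simp: L0_def L0_le_class)
  qed
qed

lemma istopology_Tc:
  fixes E :: "('a, 'e, 'm) module_scheme"
  assumes closed: "\<And>x y. x \<in> carrier E \<Longrightarrow> y \<in> carrier E \<Longrightarrow> x \<oplus>\<^bsub>E\<^esub> y \<in> carrier E"
    and sn: "\<And>n. n \<in> \<N> \<Longrightarrow> n \<in> carrier E \<rightarrow> carrier (L0_plus P)"
  shows "istopology (Tc_open P E \<N>)"
  unfolding istopology_def
proof (intro conjI allI impI)
  fix G H assume G: "Tc_open P E \<N> G" and H: "Tc_open P E \<N> H"
  have "\<exists>Q \<epsilon>. finite Q \<and> Q \<subseteq> \<N> \<and> \<epsilon> \<in> L0_pplus P \<and>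
        {x \<oplus>\<^bsub>E\<^esub> y | y. y \<in> carrier E \<and> L0_le P (seminorm_sup P Q y) \<epsilon>} \<subseteq> G \<inter> H"
    if x: "x \<in> G \<inter> H" for x
  proof -
    obtain Q \<epsilon> where Q: "finite Q" "Q \<subseteq> \<N>" "\<epsilon> \<in> L0_pplus P"
        "{x \<oplus>\<^bsub>E\<^esub> y | y. y \<in> carrier E \<and> L0_le P (seminorm_sup P Q y) \<epsilon>} \<subseteq> G"
      using G x by (auto simp: Tc_open_def)
    obtain R \<delta> where R: "finite R" "R \<subseteq> \<N>" "\<delta> \<in> L0_pplus P"
        "{x \<oplus>\<^bsub>E\<^esub> y | y. y \<in> carrier E \<and> L0_le P (seminorm_sup P R y) \<delta>} \<subseteq> H"
      using H x by (auto simp: Tc_open_def)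
    obtain \<gamma> where \<gamma>: "\<gamma> \<in> L0_pplus P"
      "\<And>X. X \<in> carrier (L0 P) \<Longrightarrow> L0_le P X \<gamma> \<Longrightarrow> L0_le P X \<epsilon> \<and> L0_le P X \<delta>"
      using L0_pplus_min[OF Q(3) R(3)] by blast
    have iff: "L0_le P (seminorm_sup P S y) \<eta> \<longleftrightarrow> (\<forall>n\<in>S. L0_le P (n y) \<eta>)"
      if "finite S" "S \<subseteq> \<N>" "\<eta> \<in> L0_pplus P" "y \<in> carrier E" for S \<eta> y
      using that sn L0_sup_le_iff[of "(\<lambda>n. n y) ` S" P \<eta>]
      by (auto simp: seminorm_sup_def L0_pplus_def Pi_iff subset_iff)
    have "L0_le P (seminorm_sup P Q y) \<epsilon> \<and> L0_le P (seminorm_sup P R y) \<delta>"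
      if y: "y \<in> carrier E" "L0_le P (seminorm_sup P (Q \<union> R) y) \<gamma>" for y
    proof -
      have "\<forall>n\<in>Q \<union> R. L0_le P (n y) \<gamma>" using iff[of "Q \<union> R" \<gamma> y] y Q R \<gamma> by auto
      moreover have "n y \<in> carrier (L0 P)" if "n \<in> Q \<union> R" for n
        using that sn[of n] Q R y by (auto simp: L0_plus_def Pi_iff)
      ultimately show ?thesis using \<gamma>(2) iff[of Q \<epsilon> y] iff[of R \<delta> y] Q R y by blast
    qed
    then show ?thesis using Q R \<gamma>(1) by (intro exI[of _ "Q \<union> R"] exI[of _ \<gamma>]) blast
  qed
  moreover have "G \<inter> H \<subseteq> carrier E" using G by (auto simp: Tc_open_def)
  ultimately show "Tc_open P E \<N> (G \<inter> H)" by (simp add: Tc_open_def)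
next
  fix \<G> assume *: "\<forall>G\<in>\<G>. Tc_open P E \<N> G"
  then have "\<Union>\<G> \<subseteq> carrier E" by (auto simp: Tc_open_def)
  moreover have "\<exists>Q \<epsilon>. finite Q \<and> Q \<subseteq> \<N> \<and> \<epsilon> \<in> L0_pplus P \<and>
        {x \<oplus>\<^bsub>E\<^esub> y | y. y \<in> carrier E \<and> L0_le P (seminorm_sup P Q y) \<epsilon>} \<subseteq> \<Union>\<G>"
    if x: "x \<in> \<Union>\<G>" for x
  proof -
    obtain G where G: "G \<in> \<G>" "x \<in> G" using x by blast
    with * obtain Q \<epsilon> where "finite Q" "Q \<subseteq> \<N>" "\<epsilon> \<in> L0_pplus P"
        "{x \<oplus>\<^bsub>E\<^esub> y | y. y \<in> carrier E \<and> L0_le P (seminorm_sup P Q y) \<epsilon>} \<subseteq> G"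
      unfolding Tc_open_def by meson
    with G show ?thesis by blast
  qed
  ultimately show "Tc_open P E \<N> (\<Union>\<G>)" by (simp add: Tc_open_def)
qed

lemma (in random_lc_module) openin_Tc: "openin (Tc P E \<N>) = Tc_open P E \<N>"
  unfolding Tc_def using seminorm
  by (intro topology_inverse' istopology_Tc) (auto simp: L0_seminorm_def)

lemma L0_abs_closed:
  "L0_abs P \<in> carrier (L0 P :: (_, ('w \<Rightarrow> 'k::{real_normed_field, second_countable_topology}) set) module)
     \<rightarrow> carrier (L0_plus P)"
  by (auto simp: L0_plus_def L0_def L0_map_class L0_le_class)

lemma openin_Tc_L0:
  "openin (Tc P (L0 P :: (_, ('w \<Rightarrow> 'k::{real_normed_field, second_countable_topology}) set) module)
     {L0_abs P}) = Tc_open P (L0 P :: (_, ('w \<Rightarrow> 'k) set) module) {L0_abs P}"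
proof -
  interpret cring "L0 P :: (_, ('w \<Rightarrow> 'k) set) module" by (rule L0_cring)
  show ?thesis unfolding Tc_def
    by (intro topology_inverse' istopology_Tc) (use L0_abs_closed in auto)
qed

lemma (in prob_space) random_lc_module_L0:
  "random_lc_module M
     (L0 M :: (_, ('a \<Rightarrow> 'k::{real_normed_field, second_countable_topology}) set) module) {L0_abs M}"
proof -
  interpret m: Module.module "(L0 M :: (_, ('a \<Rightarrow> 'k::{real_normed_field, second_countable_topology}) set) module)" "(L0 M :: (_, ('a \<Rightarrow> 'k::{real_normed_field, second_countable_topology}) set) module)" by (rule L0_module_self)
  show ?thesis
  proof unfold_locales
  fix n assume "n \<in> {L0_abs M :: ('a \<Rightarrow> 'k) set \<Rightarrow> _}"
  then show "L0_seminorm M (L0 M :: (_, ('a \<Rightarrow> 'k) set) module) n"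
    using L0_abs_closed by (auto simp: L0_seminorm_def L0_def L0_map_class L0_map2_class L0_le_class norm_mult norm_triangle_ineq)
  next
    fix x assume x: "x \<in> carrier (L0 M :: (_, ('a \<Rightarrow> 'k) set) module)"
    then obtain f :: "'a \<Rightarrow> 'k" where f: "f \<in> borel_measurable M" "x = L0_class M f" by (auto simp: L0_def)
    have 0: "\<zero>\<^bsub>L0 M\<^esub> \<in> carrier (L0_plus M)" by (auto simp: L0_plus_def L0_def L0_le_class)
    have le: "le (L0_plus M) = L0_le M" by (simp add: L0_plus_def)
    have ax: "L0_abs M x \<in> carrier (L0_plus M)" using x L0_abs_closed by blast
    have "least (L0_plus M) \<zero>\<^bsub>L0 M\<^esub> (Upper (L0_plus M) {L0_abs M x}) \<longleftrightarrow> L0_le M (L0_abs M x) \<zero>\<^bsub>L0 M\<^esub>"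
      using 0 ax by (auto simp: least_def Upper_def le) (auto simp: L0_plus_def)
    also have "\<dots> \<longleftrightarrow> x = \<zero>\<^bsub>L0 M\<^esub>"
      using f by (simp add: L0_def L0_map_class L0_le_class L0_class_eq)
    finally show "least (L0_plus M) \<zero>\<^bsub>L0 M\<^esub> (Upper (L0_plus M) ((\<lambda>n. n x) ` {L0_abs M})) = (x = \<zero>\<^bsub>L0 M\<^esub>)" by simp
  qed
qed

lemma (in prob_space) is_ess_sup_sets_ess_sup_sets:
  assumes "\<A> \<subseteq> sets M"
  shows "is_ess_sup_sets M \<A> (ess_sup_sets M \<A>)"
proof -
  define \<U> where "\<U> = {\<Union>\<C> | \<C>. countable \<C> \<and> \<C> \<subseteq> \<A>}"
  have \<U>_iff: "U \<in> \<U> \<longleftrightarrow> (\<exists>\<C>. countable \<C> \<and> \<C> \<subseteq> \<A> \<and> U = \<Union>\<C>)" for U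
    unfolding \<U>_def by auto
  have \<U>_sets: "U \<in> sets M" if U: "U \<in> \<U>" for U
  proof -
    obtain \<C> where "countable \<C>" "\<C> \<subseteq> \<A>" "U = \<Union>\<C>" using U \<U>_iff by auto
    then show ?thesis using assms sets.countable_Union[of \<C> M] by blast
  qed
  define s where "s = (SUP U\<in>\<U>. prob U)"
  have ne: "\<U> \<noteq> {}" unfolding \<U>_def by blast
  have bdd: "bdd_above (prob ` \<U>)" by (rule bdd_aboveI[of _ 1]) auto
  have "\<exists>U\<in>\<U>. s - 1 / Suc n < prob U" for n
    unfolding s_def using less_cSUP_iff[OF ne bdd, of "s - 1 / Suc n"] by (simp add: s_def)
  then obtain U where U: "\<And>n::nat. U n \<in> \<U>" "\<And>n. s - 1 / Suc n < prob (U n)" by metis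
  define S where "S = (\<Union>n. U n)"
  from U(1) have "\<forall>n. \<exists>\<C>. countable \<C> \<and> \<C> \<subseteq> \<A> \<and> U n = \<Union>\<C>" unfolding \<U>_iff by simp
  then obtain \<C> where \<C>: "\<And>n. countable (\<C> n)" "\<And>n. \<C> n \<subseteq> \<A>" "\<And>n. U n = \<Union>(\<C> n)" by metis
  have S_eq: "S = \<Union>(\<Union>n. \<C> n)" unfolding S_def using \<C>(3) by auto
  have cC: "countable (\<Union>n. \<C> n)" "(\<Union>n. \<C> n) \<subseteq> \<A>" using \<C> by auto
  have S_sets: "S \<in> sets M" using U \<U>_sets by (auto simp: S_def)
  have s_le: "s \<le> prob S"
  proof (rule field_le_epsilon)
    fix e :: real assume "0 < e"
    then obtain n where "1 / Suc n < e" using nat_approx_posE by blast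
    moreover have "prob (U n) \<le> prob S" using S_sets by (intro finite_measure_mono) (auto simp: S_def)
    ultimately show "s \<le> prob S + e" using U(2)[of n] by linarith
  qed
  have "is_ess_sup_sets M \<A> S" unfolding is_ess_sup_sets_def
  proof (intro conjI ballI impI)
    fix A assume A: "A \<in> \<A>"
    have "A \<union> S = \<Union>(insert A (\<Union>n. \<C> n))" using S_eq by simp
    moreover have "countable (insert A (\<Union>n. \<C> n))" "insert A (\<Union>n. \<C> n) \<subseteq> \<A>" using cC A by auto
    ultimately have "A \<union> S \<in> \<U>" unfolding \<U>_iff by metis
    then have "prob (A \<union> S) \<le> s" unfolding s_def by (intro cSUP_upper bdd)
    moreover have "prob (A \<union> S) = prob S + prob (A - S)"
      using A assms S_sets finite_measure_Union'[of S A] by (auto simp: Un_commute)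
    ultimately have "prob (A - S) = 0" using s_le measure_nonneg[of M "A - S"] by linarith
    then have "AE w in M. w \<notin> A - S" using prob_eq_0[of "A - S"] A assms S_sets by auto
    then show "AE w in M. w \<in> A \<longrightarrow> w \<in> S" by eventually_elim auto
  next
    fix T assume T: "\<forall>A\<in>\<A>. AE w in M. w \<in> A \<longrightarrow> w \<in> T"
    have "AE w in M. \<forall>A\<in>(\<Union>n. \<C> n). w \<in> A \<longrightarrow> w \<in> T"
      using T cC by (subst AE_ball_countable) auto
    then show "AE w in M. w \<in> S \<longrightarrow> w \<in> T" unfolding S_eq by eventually_elim auto
  qed (rule S_sets)
  then show ?thesis unfolding ess_sup_sets_def by (rule someI)
qed

end

theory Submission
  imports Defs
begin

text \<open>A random linear functional is built by Zorn's lemma from a cone of pairs \<open>(x, h)\<close>, read as the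
  constraint \<open>f x \<le> h\<close> on \<open>H = H(M,G)\<close>. Fix \<open>x\<^sub>0 \<in> G\<close>, \<open>y\<^sub>0 \<in> M\<close> and \<open>z = y\<^sub>0 - x\<^sub>0\<close>; the initial cone
  demands \<open>f \<le> 0\<close> on \<open>G - M\<close> and \<open>f z = 1\<close>. It is consistent: a constraint \<open>0 \<le> h\<close> with \<open>h < 0\<close> on
  \<open>A \<subseteq> H\<close> would, by \<open>L\<^sup>0\<close>-convexity, produce points of \<open>G\<close> and \<open>M\<close> that agree on \<open>A\<close>, so \<open>A\<close> is null.
  It constrains every \<open>x\<close> because \<open>G\<close> contains an absorbing neighbourhood of \<open>x\<^sub>0\<close>. In a maximal cone
  every \<open>x\<close> has an \<open>r\<close>, an essential infimum, with both \<open>(x, r)\<close> and \<open>(-x, -r)\<close>, and \<open>f x = r\<close>.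
  Openness of \<open>G\<close> makes the inequality strict on \<open>H\<close>. Off \<open>H\<close> we put \<open>f = 0\<close>; the second claim then
  says that \<open>H\<close> is not null, which is what disjointness of the concatenation hulls provides.\<close>

section \<open>Essential infima\<close>

text \<open>The infimum is read off from the sublevel sets: up to null sets, \<open>{r < q}\<close> is the essential
  supremum of the sets \<open>{k < q}\<close>, for rational \<open>q\<close>.\<close>

lemma (in prob_space) essential_infimum_exists:
  fixes F :: "('a \<Rightarrow> real) set"
  assumes ne: "F \<noteq> {}" and meas: "F \<subseteq> borel_measurable M"
    and b: "b \<in> borel_measurable M" and lb: "\<And>k. k \<in> F \<Longrightarrow> AE w in M. b w \<le> k w"
  obtains r where "r \<in> borel_measurable M" "\<And>k. k \<in> F \<Longrightarrow> AE w in M. r w \<le> k w"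
    "\<And>c. c \<in> borel_measurable M \<Longrightarrow> (\<And>k. k \<in> F \<Longrightarrow> AE w in M. c w \<le> k w) \<Longrightarrow> AE w in M. c w \<le> r w"
proof -
  define \<A> where "\<A> q = (\<lambda>k. {w \<in> space M. k w < real_of_rat q}) ` F" for q
  define A where "A q = ess_sup_sets M (\<A> q)" for q
  have "\<A> q \<subseteq> sets M" for q
    using meas by (auto simp: \<A>_def)
  then have A: "is_ess_sup_sets M (\<A> q) (A q)" for q
    unfolding A_def by (rule is_ess_sup_sets_ess_sup_sets)
  then have A_sets [measurable]: "A q \<in> sets M" for q
    by (simp add: is_ess_sup_sets_def)
  \<comment> \<open>Extended values cover the points that lie in no \<open>A q\<close>, where
    \<open>s\<close> is infinite. The rationals are countable, which makes \<open>s\<close>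
    measurable.\<close>
  define s :: "'a \<Rightarrow> ereal" where
    "s w = (INF q. if w \<in> A q then ereal (real_of_rat q) else \<infinity>)" for w
  have s_meas [measurable]: "s \<in> borel_measurable M"
    unfolding s_def by measurable
  have s_le: "AE w in M. s w \<le> ereal (k w)" if k: "k \<in> F" for k
  proof -
    have "AE w in M. w \<in> {w \<in> space M. k w < real_of_rat q} \<longrightarrow> w \<in> A q" for q
      using A[of q] k unfolding is_ess_sup_sets_def \<A>_def by blast
    then have "AE w in M. \<forall>q. w \<in> {w \<in> space M. k w < real_of_rat q} \<longrightarrow> w \<in> A q"
      by (simp add: AE_all_countable)
    then show ?thesis
      using AE_space
    proof eventually_elim
      case (elim w)
      show ?case
      proof (rule dense_ge)
        fix t assume "ereal (k w) < t"
        then obtain u where u: "k w < u" "ereal u < t"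
          using ereal_dense2 by force
        then obtain q where q: "k w < real_of_rat q" "real_of_rat q < u"
          using of_rat_dense by blast
        then have "w \<in> A q" using elim by auto
        then have "s w \<le> ereal (real_of_rat q)"
          unfolding s_def by (intro INF_lower2[of q]) auto
        also have "\<dots> \<le> t" using q u by (metis ereal_less_eq(3) less_imp_le order_trans)
        finally show "s w \<le> t" .
      qed
    qed
  qed
  have s_ge: "AE w in M. ereal (c w) \<le> s w"
    if c [measurable]: "c \<in> borel_measurable M" and ck: "\<And>k. k \<in> F \<Longrightarrow> AE w in M. c w \<le> k w" for c
  proof -
    \<comment> \<open>Every set \<open>{k < q}\<close> lies in \<open>{c < q}\<close> almost surely,
      and \<open>A q\<close> is the least set containing them all.\<close>
    have "AE w in M. w \<in> A q \<longrightarrow> w \<in> {w \<in> space M. c w < real_of_rat q}" for q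
    proof -
      have "\<forall>B\<in>\<A> q. AE w in M. w \<in> B \<longrightarrow> w \<in> {w \<in> space M. c w < real_of_rat q}"
      proof
        fix B assume "B \<in> \<A> q"
        then obtain k where "k \<in> F" "B = {w \<in> space M. k w < real_of_rat q}"
          by (auto simp: \<A>_def)
        then show "AE w in M. w \<in> B \<longrightarrow> w \<in> {w \<in> space M. c w < real_of_rat q}"
          using ck[of k] by auto
      qed
      moreover have "{w \<in> space M. c w < real_of_rat q} \<in> sets M" by measurable
      ultimately show ?thesis
        using A[of q] unfolding is_ess_sup_sets_def by blast
    qed
    then have "AE w in M. \<forall>q. w \<in> A q \<longrightarrow> w \<in> {w \<in> space M. c w < real_of_rat q}"
      by (simp add: AE_all_countable)
    then show ?thesis
    proof eventually_elim
      case (elim w)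
      then have "ereal (c w) \<le> (if w \<in> A q then ereal (real_of_rat q) else \<infinity>)" for q
        by (simp add: less_imp_le)
      then show ?case unfolding s_def by (rule INF_greatest)
    qed
  qed
  obtain k0 where k0: "k0 \<in> F" using ne by blast
  \<comment> \<open>The lower bound \<open>b\<close> and one member \<open>k0\<close> of
    \<open>F\<close> squeeze \<open>s\<close> between real values, so passing back from
    \<open>ereal\<close> loses nothing.\<close>
  have fin: "AE w in M. ereal (real_of_ereal (s w)) = s w"
    using s_le[OF k0] s_ge[OF b lb, simplified]
  proof eventually_elim
    case (elim w)
    then show ?case by (cases "s w") auto
  qed
  show thesis
  proof
    show "(\<lambda>w. real_of_ereal (s w)) \<in> borel_measurable M" by measurable
    show "AE w in M. real_of_ereal (s w) \<le> k w" if "k \<in> F" for k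
      using fin s_le[OF that] by eventually_elim (metis ereal_less_eq(3))
    show "AE w in M. c w \<le> real_of_ereal (s w)"
      if "c \<in> borel_measurable M" "\<And>k. k \<in> F \<Longrightarrow> AE w in M. c w \<le> k w" for c
    proof -
      have "AE w in M. ereal (c w) \<le> s w"
        using that by (rule s_ge)
      with fin show ?thesis by eventually_elim (metis ereal_less_eq(3))
    qed
  qed
qed

section \<open>Calculus of classes\<close>

lemma L0_class_closed [simp]:
  "f \<in> borel_measurable P \<Longrightarrow> L0_class P f \<in> carrier (L0 P)"
  by (simp add: L0_def)

lemma L0_carrierE:
  assumes "X \<in> carrier (L0 P)"
  obtains f where "f \<in> borel_measurable P" "X = L0_class P f"
  using assms by (auto simp: L0_def)

lemma L0_class_add:
  fixes f g :: "'w \<Rightarrow> 'k::{real_normed_field, second_countable_topology}"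
  assumes "f \<in> borel_measurable P" "g \<in> borel_measurable P"
  shows "L0_class P f \<oplus>\<^bsub>L0 P\<^esub> L0_class P g = L0_class P (\<lambda>w. f w + g w)"
  using assms by (simp add: L0_def L0_map2_class)

lemma L0_class_mult:
  fixes f g :: "'w \<Rightarrow> 'k::{real_normed_field, second_countable_topology}"
  assumes "f \<in> borel_measurable P" "g \<in> borel_measurable P"
  shows "L0_class P f \<otimes>\<^bsub>L0 P\<^esub> L0_class P g = L0_class P (\<lambda>w. f w * g w)"
    and "L0_class P f \<odot>\<^bsub>L0 P\<^esub> L0_class P g = L0_class P (\<lambda>w. f w * g w)"
  using assms by (simp_all add: L0_def L0_map2_class)

lemma L0_class_minus:
  fixes f g :: "'w \<Rightarrow> 'k::{real_normed_field, second_countable_topology}"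
  assumes [measurable]: "f \<in> borel_measurable P" "g \<in> borel_measurable P"
  shows "L0_class P f \<ominus>\<^bsub>L0 P\<^esub> L0_class P g = L0_class P (\<lambda>w. f w - g w)"
proof -
  interpret cring "L0 P :: (_, ('w \<Rightarrow> 'k) set) module" by (rule L0_cring)
  have "\<ominus>\<^bsub>L0 P\<^esub> L0_class P g = L0_class P (\<lambda>w. - g w)"
    by (rule minus_equality) (simp_all add: L0_class_add, simp add: L0_def)
  then show ?thesis
    by (simp add: a_minus_def L0_class_add)
qed

lemma L0_zero: "\<zero>\<^bsub>L0 P\<^esub> = L0_class P (\<lambda>_. 0)"
  by (simp add: L0_def)

lemma L0_one: "\<one>\<^bsub>L0 P\<^esub> = L0_class P (\<lambda>_. 1)"
  by (simp add: L0_def)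

lemma L0_plus_carrier_iff:
  assumes "f \<in> borel_measurable P"
  shows "L0_class P f \<in> carrier (L0_plus P) \<longleftrightarrow> (AE w in P. 0 \<le> f w)"
  using assms by (simp add: L0_plus_def L0_zero L0_le_class)

text \<open>Changing the representative to 1 on a null set makes it positive at every point, so that
  later divisions by it need no exceptional set.\<close>

lemma L0_pplusE:
  assumes "\<epsilon> \<in> L0_pplus P"
  obtains e where "e \<in> borel_measurable P" "\<And>w. 0 < e w" "\<epsilon> = L0_class P e"
proof -
  obtain f where f [measurable]: "f \<in> borel_measurable P" and \<epsilon>: "\<epsilon> = L0_class P f"
    using assms by (auto simp: L0_pplus_def L0_plus_def elim: L0_carrierE)
  have "AE w in P. 0 < f w"
    using assms \<epsilon> by (simp add: L0_pplus_def L0_zero L0_less_on_class)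
  then have "L0_class P f = L0_class P (\<lambda>w. if 0 < f w then f w else 1)"
    by (subst L0_class_eq) auto
  with \<epsilon> show thesis
    by (intro that[of "\<lambda>w. if 0 < f w then f w else 1"]) auto
qed

lemma L0_pplus_class:
  assumes "e \<in> borel_measurable P" "\<And>w. 0 < e w"
  shows "L0_class P e \<in> L0_pplus P"
  using assms by (simp add: L0_pplus_def L0_plus_carrier_iff L0_zero L0_less_on_class less_imp_le)

section \<open>Separation by random linear functionals\<close>

context random_lc_module
begin

text \<open>Scalars are real functions, not classes: one argument then serves
  \<open>'k = real\<close> and \<open>'k = complex\<close>, and pointwise case distinctions are at
  hand.\<close>

definition real_smult :: "('w \<Rightarrow> real) \<Rightarrow> 'e \<Rightarrow> 'e" (infixr "\<triangleright>" 78) where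
  "a \<triangleright> x = L0_class P (\<lambda>w. of_real (a w) :: 'k) \<odot>\<^bsub>E\<^esub> x"



lemma real_smult_closed [simp]:
  "a \<in> borel_measurable P \<Longrightarrow> x \<in> carrier E \<Longrightarrow> a \<triangleright> x \<in> carrier E"
  by (simp add: real_smult_def)

lemma real_smult_add_left:
  assumes "a \<in> borel_measurable P" "b \<in> borel_measurable P" "x \<in> carrier E"
  shows "(\<lambda>w. a w + b w) \<triangleright> x = a \<triangleright> x \<oplus>\<^bsub>E\<^esub> b \<triangleright> x"
  using assms by (simp add: real_smult_def L0_class_add flip: smult_l_distr)

lemma real_smult_add_right:
  assumes "a \<in> borel_measurable P" "x \<in> carrier E" "y \<in> carrier E"
  shows "a \<triangleright> (x \<oplus>\<^bsub>E\<^esub> y) = a \<triangleright> x \<oplus>\<^bsub>E\<^esub> a \<triangleright> y"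
  using assms by (simp add: real_smult_def smult_r_distr)

lemma real_smult_real_smult:
  assumes "a \<in> borel_measurable P" "b \<in> borel_measurable P" "x \<in> carrier E"
  shows "a \<triangleright> b \<triangleright> x = (\<lambda>w. a w * b w) \<triangleright> x"
  using assms by (simp add: real_smult_def L0_class_mult flip: smult_assoc1)

lemma real_smult_one [simp]: "x \<in> carrier E \<Longrightarrow> (\<lambda>_. 1) \<triangleright> x = x"
  by (simp add: real_smult_def flip: L0_one)

lemma real_smult_zero_left [simp]: "x \<in> carrier E \<Longrightarrow> (\<lambda>_. 0) \<triangleright> x = \<zero>\<^bsub>E\<^esub>"
  by (simp add: real_smult_def flip: L0_zero)

lemma real_smult_zero_right [simp]: "a \<in> borel_measurable P \<Longrightarrow> a \<triangleright> \<zero>\<^bsub>E\<^esub> = \<zero>\<^bsub>E\<^esub>"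
  by (simp add: real_smult_def)

lemma real_smult_minus_right:
  "a \<in> borel_measurable P \<Longrightarrow> x \<in> carrier E \<Longrightarrow> a \<triangleright> (\<ominus>\<^bsub>E\<^esub> x) = \<ominus>\<^bsub>E\<^esub> (a \<triangleright> x)"
  by (simp add: real_smult_def smult_r_minus)

lemma real_smult_minus_left:
  assumes "a \<in> borel_measurable P" "x \<in> carrier E"
  shows "(\<lambda>w. - a w) \<triangleright> x = \<ominus>\<^bsub>E\<^esub> (a \<triangleright> x)"
proof (rule M.minus_equality[symmetric])
  show "(\<lambda>w. - a w) \<triangleright> x \<oplus>\<^bsub>E\<^esub> a \<triangleright> x = \<zero>\<^bsub>E\<^esub>"
    using assms by (simp flip: real_smult_add_left)
qed (use assms in auto)

lemma real_smult_cong_AE: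
  assumes "a \<in> borel_measurable P" "b \<in> borel_measurable P" "AE w in P. a w = b w"
  shows "a \<triangleright> x = b \<triangleright> x"
proof -
  have "L0_class P (\<lambda>w. of_real (a w) :: 'k) = L0_class P (\<lambda>w. of_real (b w))"
    using assms by (subst L0_class_eq) auto
  then show ?thesis by (simp add: real_smult_def)
qed

lemma ind_smult:
  "L0_ind P A \<odot>\<^bsub>E\<^esub> x = indicator A \<triangleright> x"
proof -
  have "(indicator A :: 'w \<Rightarrow> 'k) = (\<lambda>w. of_real (indicator A w))"
    by (auto simp: indicator_def)
  then show ?thesis by (simp add: real_smult_def)
qed

lemma L0_convexD:
  assumes "L0_convex P E G" "x \<in> G" "y \<in> G"
    and [measurable]: "a \<in> borel_measurable P" and "\<And>w. 0 \<le> a w" "\<And>w. a w \<le> 1"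
  shows "a \<triangleright> x \<oplus>\<^bsub>E\<^esub> (\<lambda>w. 1 - a w) \<triangleright> y \<in> G"
proof -
  have "L0_class P a \<in> carrier (L0_plus P)" "L0_le P (L0_class P a) \<one>\<^bsub>L0 P\<^esub>"
    using assms by (simp_all add: L0_plus_carrier_iff L0_one L0_le_class)
  then have "L0_of_real P (L0_class P a) \<odot>\<^bsub>E\<^esub> x \<oplus>\<^bsub>E\<^esub>
      L0_of_real P (\<one>\<^bsub>L0 P\<^esub> \<ominus>\<^bsub>L0 P\<^esub> L0_class P a) \<odot>\<^bsub>E\<^esub> y \<in> G"
    using assms by (auto simp: L0_convex_def)
  then show ?thesis
    by (simp add: real_smult_def L0_one L0_class_minus L0_map_class)
qed

subsection \<open>The Hahn-Banach theorem\<close>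

text \<open>A cone in the sense below plays the role of the epigraph of a sublinear map; enlarging the cone
  makes the map smaller. Working with cones instead of maps, chains are bounded by their
  unions.\<close>

definition epi_cone :: "'w set \<Rightarrow> ('e \<times> ('w \<Rightarrow> real)) set \<Rightarrow> bool" where
  "epi_cone H K \<longleftrightarrow> K \<subseteq> carrier E \<times> borel_measurable P \<and>
     (\<forall>x h y k. (x, h) \<in> K \<longrightarrow> (y, k) \<in> K \<longrightarrow> (x \<oplus>\<^bsub>E\<^esub> y, \<lambda>w. h w + k w) \<in> K) \<and>
     (\<forall>a x h. a \<in> borel_measurable P \<longrightarrow> (\<forall>w. 0 \<le> a w) \<longrightarrow> (x, h) \<in> K \<longrightarrow>
        (a \<triangleright> x, \<lambda>w. a w * h w) \<in> K) \<and>
     (\<forall>h. (\<zero>\<^bsub>E\<^esub>, h) \<in> K \<longrightarrow> (AE w in P. w \<in> H \<longrightarrow> 0 \<le> h w))"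

lemma epi_coneD:
  assumes "epi_cone H K"
  shows "(x, h) \<in> K \<Longrightarrow> x \<in> carrier E" "(x, h) \<in> K \<Longrightarrow> h \<in> borel_measurable P"
    and "(x, h) \<in> K \<Longrightarrow> (y, k) \<in> K \<Longrightarrow> (x \<oplus>\<^bsub>E\<^esub> y, \<lambda>w. h w + k w) \<in> K"
    and "a \<in> borel_measurable P \<Longrightarrow> (\<And>w. 0 \<le> a w) \<Longrightarrow> (x, h) \<in> K \<Longrightarrow> (a \<triangleright> x, \<lambda>w. a w * h w) \<in> K"
    and "(\<zero>\<^bsub>E\<^esub>, h) \<in> K \<Longrightarrow> AE w in P. w \<in> H \<longrightarrow> 0 \<le> h w"
  using assms unfolding epi_cone_def by blast+

text \<open>The sum of the two constraints is one on the null element, which consistency controls.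
  So every upper bound for \<open>x\<close> dominates every lower bound \<open>- k\<close>, almost
  surely on \<open>H\<close>.\<close>

lemma epi_cone_opposite:
  assumes K: "epi_cone H K" and "(x, h) \<in> K" "(\<ominus>\<^bsub>E\<^esub> x, k) \<in> K"
  shows "AE w in P. w \<in> H \<longrightarrow> 0 \<le> h w + k w"
proof -
  have "(x \<oplus>\<^bsub>E\<^esub> \<ominus>\<^bsub>E\<^esub> x, \<lambda>w. h w + k w) \<in> K"
    using epi_coneD(3)[OF assms] .
  then show ?thesis
    using epi_coneD(1)[OF K assms(2)] epi_coneD(5)[OF K] by (simp add: M.r_neg)
qed

lemma epi_cone_Union:
  assumes "\<C> \<noteq> {}" "subset.chain {K. epi_cone H K} \<C>"
  shows "epi_cone H (\<Union>\<C>)"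
proof -
  have epi: "epi_cone H K" if "K \<in> \<C>" for K
    using assms that by (auto simp: subset.chain_def)
  \<comment> \<open>Members of a chain are comparable, so two constraints always share a member; the
    closure conditions never involve more than two.\<close>
  have "\<exists>K\<in>\<C>. u \<in> K \<and> v \<in> K" if "u \<in> \<Union>\<C>" "v \<in> \<Union>\<C>" for u v
    using assms(2) that unfolding subset.chain_def subset_chain_def by blast
  then have "(x \<oplus>\<^bsub>E\<^esub> y, \<lambda>w. h w + k w) \<in> \<Union>\<C>" if "(x, h) \<in> \<Union>\<C>" "(y, k) \<in> \<Union>\<C>" for x y h k
    using that epi epi_coneD(3) by (meson Union_iff)
  moreover have "\<Union>\<C> \<subseteq> carrier E \<times> borel_measurable P"
    using epi unfolding epi_cone_def by blast
  moreover have "(a \<triangleright> x, \<lambda>w. a w * h w) \<in> \<Union>\<C>"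
    if "a \<in> borel_measurable P" "\<forall>w. 0 \<le> a w" "(x, h) \<in> \<Union>\<C>" for a x h
    using that epi epi_coneD(4) by (meson Union_iff)
  moreover have "AE w in P. w \<in> H \<longrightarrow> 0 \<le> h w" if "(\<zero>\<^bsub>E\<^esub>, h) \<in> \<Union>\<C>" for h
    using that epi epi_coneD(5) by (meson Union_iff)
  ultimately show ?thesis
    unfolding epi_cone_def by blast
qed

lemma epi_cone_maximal:
  assumes "epi_cone H K0"
  obtains K where "epi_cone H K" "K0 \<subseteq> K" "\<And>K'. epi_cone H K' \<Longrightarrow> K \<subseteq> K' \<Longrightarrow> K' = K"
proof -
  have "\<exists>K\<in>{K. epi_cone H K \<and> K0 \<subseteq> K}. \<forall>X\<in>{K. epi_cone H K \<and> K0 \<subseteq> K}. K \<subseteq> X \<longrightarrow> X = K"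
  proof (rule subset_Zorn_nonempty)
    fix \<C> assume \<C>: "\<C> \<noteq> {}" "subset.chain {K. epi_cone H K \<and> K0 \<subseteq> K} \<C>"
    then have "subset.chain {K. epi_cone H K} \<C>"
      by (auto simp: subset.chain_def)
    then have "epi_cone H (\<Union>\<C>)" by (rule epi_cone_Union[OF \<C>(1)])
    moreover have "K0 \<subseteq> \<Union>\<C>"
      using \<C> by (force simp: subset.chain_def)
    ultimately show "\<Union>\<C> \<in> {K. epi_cone H K \<and> K0 \<subseteq> K}" by simp
  qed (use assms in blast)
  then obtain K where K: "epi_cone H K \<and> K0 \<subseteq> K"
    "\<forall>X\<in>{K. epi_cone H K \<and> K0 \<subseteq> K}. K \<subseteq> X \<longrightarrow> X = K" by auto
  \<comment> \<open>Zorn was applied to the cones above \<open>K0\<close>; a cone containing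
    \<open>K\<close> contains \<open>K0\<close>, so \<open>K\<close> is maximal among all
    cones.\<close>
  have "K' = K" if "epi_cone H K'" "K \<subseteq> K'" for K'
    using K that order_trans[of K0 K K'] by simp
  with K(1) show thesis by (intro that[of K]) simp_all
qed

text \<open>This is the one-step extension in Hahn-Banach. By \<open>le\<close>, the value
  \<open>r\<close> at \<open>x\<close> conflicts with no constraint on the negative of
  \<open>x\<close>; hence the cone generated by \<open>K\<close> and \<open>(x, r)\<close> is still
  consistent, and by maximality it is \<open>K\<close>.\<close>

lemma epi_cone_maximal_mem:
  assumes K: "epi_cone H K" and max: "\<And>K'. epi_cone H K' \<Longrightarrow> K \<subseteq> K' \<Longrightarrow> K' = K"
    and x: "x \<in> carrier E" and r [measurable]: "r \<in> borel_measurable P"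
    and k0: "(\<ominus>\<^bsub>E\<^esub> x, k0) \<in> K"
    and le: "\<And>k. (\<ominus>\<^bsub>E\<^esub> x, k) \<in> K \<Longrightarrow> AE w in P. w \<in> H \<longrightarrow> - r w \<le> k w"
  shows "(x, r) \<in> K"
proof -
  note [simp] = epi_coneD(1)[OF K]
  define K' where "K' = {(y \<oplus>\<^bsub>E\<^esub> a \<triangleright> x, \<lambda>w. h w + a w * r w) | y h a.
    (y, h) \<in> K \<and> a \<in> borel_measurable P \<and> (\<forall>w. 0 \<le> a w)}"
  have K'I: "(y \<oplus>\<^bsub>E\<^esub> a \<triangleright> x, \<lambda>w. h w + a w * r w) \<in> K'"
    if "(y, h) \<in> K" "a \<in> borel_measurable P" "\<And>w. 0 \<le> a w" for y h a
    using that unfolding K'_def by blast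
  have "epi_cone H K'"
    unfolding epi_cone_def
  proof (intro conjI allI impI)
    show "K' \<subseteq> carrier E \<times> borel_measurable P"
      using x epi_coneD(2)[OF K] by (auto simp: K'_def)
  next
    fix x1 h1 x2 h2 assume "(x1, h1) \<in> K'" "(x2, h2) \<in> K'"
    then obtain y1 k1 a1 y2 k2 a2 where
      1: "(y1, k1) \<in> K" "a1 \<in> borel_measurable P" "\<And>w. 0 \<le> a1 w"
      "x1 = y1 \<oplus>\<^bsub>E\<^esub> a1 \<triangleright> x" "h1 = (\<lambda>w. k1 w + a1 w * r w)" and
      2: "(y2, k2) \<in> K" "a2 \<in> borel_measurable P" "\<And>w. 0 \<le> a2 w"
      "x2 = y2 \<oplus>\<^bsub>E\<^esub> a2 \<triangleright> x" "h2 = (\<lambda>w. k2 w + a2 w * r w)"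
      unfolding K'_def by blast
    have "(y1 \<oplus>\<^bsub>E\<^esub> y2 \<oplus>\<^bsub>E\<^esub> (\<lambda>w. a1 w + a2 w) \<triangleright> x, \<lambda>w. k1 w + k2 w + (a1 w + a2 w) * r w) \<in> K'"
      using 1 2 by (intro K'I epi_coneD(3)[OF K]) auto
    moreover have "y1 \<oplus>\<^bsub>E\<^esub> y2 \<oplus>\<^bsub>E\<^esub> (\<lambda>w. a1 w + a2 w) \<triangleright> x = x1 \<oplus>\<^bsub>E\<^esub> x2"
      using 1 2 x by (simp add: real_smult_add_left M.a_ac)
    moreover have "(\<lambda>w. k1 w + k2 w + (a1 w + a2 w) * r w) = (\<lambda>w. h1 w + h2 w)"
      using 1 2 by (simp add: algebra_simps)
    ultimately show "(x1 \<oplus>\<^bsub>E\<^esub> x2, \<lambda>w. h1 w + h2 w) \<in> K'" by simp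
  next
    fix b :: "'w \<Rightarrow> real" and x1 h1
    assume b: "b \<in> borel_measurable P" "\<forall>w. 0 \<le> b w" and "(x1, h1) \<in> K'"
    then obtain y1 k1 a1 where
      1: "(y1, k1) \<in> K" "a1 \<in> borel_measurable P" "\<And>w. 0 \<le> a1 w"
      "x1 = y1 \<oplus>\<^bsub>E\<^esub> a1 \<triangleright> x" "h1 = (\<lambda>w. k1 w + a1 w * r w)"
      unfolding K'_def by blast
    have "(b \<triangleright> y1 \<oplus>\<^bsub>E\<^esub> (\<lambda>w. b w * a1 w) \<triangleright> x, \<lambda>w. b w * k1 w + b w * a1 w * r w) \<in> K'"
      using 1 b by (intro K'I epi_coneD(4)[OF K]) auto
    moreover have "b \<triangleright> y1 \<oplus>\<^bsub>E\<^esub> (\<lambda>w. b w * a1 w) \<triangleright> x = b \<triangleright> x1"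
      using 1 b x by (simp add: real_smult_add_right real_smult_real_smult)
    moreover have "(\<lambda>w. b w * k1 w + b w * a1 w * r w) = (\<lambda>w. b w * h1 w)"
      using 1 by (simp add: algebra_simps)
    ultimately show "(b \<triangleright> x1, \<lambda>w. b w * h1 w) \<in> K'" by simp
  next
    fix h1 assume "(\<zero>\<^bsub>E\<^esub>, h1) \<in> K'"
    then obtain y h a where 1: "(y, h) \<in> K" "a \<in> borel_measurable P" "\<And>w. 0 \<le> a w"
      "\<zero>\<^bsub>E\<^esub> = y \<oplus>\<^bsub>E\<^esub> a \<triangleright> x" "h1 = (\<lambda>w. h w + a w * r w)"
      unfolding K'_def by blast
    note [measurable] = 1(2) epi_coneD(2)[OF K 1(1)]
    have y: "y = a \<triangleright> (\<ominus>\<^bsub>E\<^esub> x)"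
      using 1 x by (simp add: real_smult_minus_right M.minus_equality)
    \<comment> \<open>\<open>b\<close> inverts \<open>a\<close> where it is nonzero and
      \<open>c\<close> marks where it vanishes. Since \<open>b * a + c = 1\<close>, adding up
      \<open>b \<triangleright> y\<close> and the \<open>c\<close>-fold negative of \<open>x\<close>
      gives exactly the negative of \<open>x\<close>, so \<open>le\<close> applies and settles the
      points with \<open>a > 0\<close>.\<close>
    define b :: "'w \<Rightarrow> real" where "b w = (if a w = 0 then 0 else 1 / a w)" for w
    define c :: "'w \<Rightarrow> real" where "c w = (if a w = 0 then 1 else 0)" for w
    have [measurable]: "b \<in> borel_measurable P" "c \<in> borel_measurable P"
      unfolding b_def c_def by measurable
    have bc: "0 \<le> b w" "0 \<le> c w" for w
      using 1(3) by (auto simp: b_def c_def)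
    have 2: "(c \<triangleright> y, \<lambda>w. c w * h w) \<in> K"
      using 1 bc by (intro epi_coneD(4)[OF K]) auto
    \<comment> \<open>Where \<open>a\<close> vanishes so does \<open>y\<close>, and the consistency
      of \<open>K\<close> itself gives \<open>0 \<le> h\<close> there.\<close>
    have "c \<triangleright> y = (\<lambda>w. c w * a w) \<triangleright> (\<ominus>\<^bsub>E\<^esub> x)"
      using x by (simp add: y real_smult_real_smult)
    also have "(\<lambda>w. c w * a w) = (\<lambda>w. 0)" by (auto simp: c_def)
    finally have ch: "AE w in P. w \<in> H \<longrightarrow> 0 \<le> c w * h w"
      using 2 x epi_coneD(5)[OF K] by simp
    have 3: "(b \<triangleright> y \<oplus>\<^bsub>E\<^esub> c \<triangleright> (\<ominus>\<^bsub>E\<^esub> x), \<lambda>w. b w * h w + c w * k0 w) \<in> K"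
      using 1 bc k0 by (intro epi_coneD(3,4)[OF K]) auto
    have "b \<triangleright> y \<oplus>\<^bsub>E\<^esub> c \<triangleright> (\<ominus>\<^bsub>E\<^esub> x) = (\<lambda>w. b w * a w + c w) \<triangleright> (\<ominus>\<^bsub>E\<^esub> x)"
      using x by (simp add: y real_smult_real_smult real_smult_add_left)
    also have "(\<lambda>w. b w * a w + c w) = (\<lambda>w. 1)" by (auto simp: b_def c_def)
    finally have "AE w in P. w \<in> H \<longrightarrow> - r w \<le> b w * h w + c w * k0 w"
      using 3 x by (intro le) simp
    with ch show "AE w in P. w \<in> H \<longrightarrow> 0 \<le> h1 w"
    proof eventually_elim
      case (elim w)
      show ?case
        using elim 1(3)[of w] by (auto simp: 1(5) b_def c_def field_simps split: if_splits)
    qed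
  qed
  moreover have "K \<subseteq> K'"
  proof
    fix u assume u: "u \<in> K"
    obtain y h where yh: "u = (y, h)" by (cases u)
    then show "u \<in> K'"
      using K'I[of y h "\<lambda>_. 0"] u x by simp
  qed
  ultimately have "K' = K" by (rule max)
  moreover have "(\<zero>\<^bsub>E\<^esub>, \<lambda>_. 0) \<in> K"
    using epi_coneD(4)[OF K, of "\<lambda>_. 0"] k0 x by fastforce
  then have "(x, r) \<in> K'"
    using K'I[of "\<zero>\<^bsub>E\<^esub>" "\<lambda>_. 0" "\<lambda>_. 1"] x by simp
  ultimately show ?thesis by simp
qed

text \<open>The essential infimum \<open>r\<close> of the upper bounds for \<open>x\<close> lies
  below each of them and above each lower bound \<open>- k\<close> coming from a constraint on the
  negative of \<open>x\<close>. Hence neither new constraint is in conflict, and maximality yields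
  both.\<close>

lemma epi_cone_maximal_graph:
  assumes K: "epi_cone H K" and max: "\<And>K'. epi_cone H K' \<Longrightarrow> K \<subseteq> K' \<Longrightarrow> K' = K"
    and H [measurable]: "H \<in> sets P"
    and total: "\<And>x. x \<in> carrier E \<Longrightarrow> \<exists>h. (x, h) \<in> K"
    and x: "x \<in> carrier E"
  shows "\<exists>r. (x, r) \<in> K \<and> (\<ominus>\<^bsub>E\<^esub> x, \<lambda>w. - r w) \<in> K"
proof -
  \<comment> \<open>Constraints bind only on \<open>H\<close>. Cutting them to 0 outside makes the
    family bounded below almost surely on the whole space.\<close>
  define F where "F = {\<lambda>w. indicator H w * h w | h. (x, h) \<in> K}"
  obtain k0 where k0: "(\<ominus>\<^bsub>E\<^esub> x, k0) \<in> K" using total x by blast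
  obtain h0 where h0: "(x, h0) \<in> K" using total x by blast
  note [measurable] = epi_coneD(2)[OF K k0] epi_coneD(2)[OF K h0]
  have lb: "AE w in P. - (indicator H w * k w) \<le> indicator H w * h w"
    if "(\<ominus>\<^bsub>E\<^esub> x, k) \<in> K" "(x, h) \<in> K" for k h
    using epi_cone_opposite[OF K that(2,1)] by eventually_elim (auto simp: indicator_def)
  have "F \<noteq> {}" "F \<subseteq> borel_measurable P"
    using h0 epi_coneD(2)[OF K] by (auto simp: F_def)
  then obtain r where r: "r \<in> borel_measurable P" "\<And>h. h \<in> F \<Longrightarrow> AE w in P. r w \<le> h w"
    "\<And>c. c \<in> borel_measurable P \<Longrightarrow> (\<And>h. h \<in> F \<Longrightarrow> AE w in P. c w \<le> h w) \<Longrightarrow> AE w in P. c w \<le> r w"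
    by (rule essential_infimum_exists[of F "\<lambda>w. - (indicator H w * k0 w)"])
      (use lb[OF k0] in \<open>auto simp: F_def\<close>)
  have "(\<ominus>\<^bsub>E\<^esub> x, \<lambda>w. - r w) \<in> K"
  proof (rule epi_cone_maximal_mem[OF K max])
    fix k assume "(\<ominus>\<^bsub>E\<^esub> (\<ominus>\<^bsub>E\<^esub> x), k) \<in> K"
    then have "(\<lambda>w. indicator H w * k w) \<in> F"
      using x by (auto simp: F_def)
    from r(2)[OF this] show "AE w in P. w \<in> H \<longrightarrow> - (- r w) \<le> k w"
      by eventually_elim auto
  qed (use r x h0 in auto)
  moreover have "(x, r) \<in> K"
  proof (rule epi_cone_maximal_mem[OF K max])
    fix k assume k: "(\<ominus>\<^bsub>E\<^esub> x, k) \<in> K"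
    note [measurable] = epi_coneD(2)[OF K k]
    have "AE w in P. - (indicator H w * k w) \<le> r w"
      using lb[OF k] by (intro r(3)) (auto simp: F_def)
    then show "AE w in P. w \<in> H \<longrightarrow> - r w \<le> k w"
      by eventually_elim auto
  qed (use r x k0 in auto)
  ultimately show ?thesis by blast
qed

text \<open>Values are representatives, so linearity holds almost surely. Homogeneity is asked for
  real multipliers only; over the complex scalars such a map is a candidate for a real part.\<close>

definition random_linear :: "('e \<Rightarrow> 'w \<Rightarrow> real) \<Rightarrow> bool" where
  "random_linear F \<longleftrightarrow> (\<forall>x\<in>carrier E. F x \<in> borel_measurable P) \<and>
     (\<forall>x\<in>carrier E. \<forall>y\<in>carrier E. AE w in P. F (x \<oplus>\<^bsub>E\<^esub> y) w = F x w + F y w) \<and>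
     (\<forall>a\<in>borel_measurable P. \<forall>x\<in>carrier E. AE w in P. F (a \<triangleright> x) w = a w * F x w)"

lemma random_linearD:
  assumes "random_linear F"
  shows "x \<in> carrier E \<Longrightarrow> F x \<in> borel_measurable P"
    and "x \<in> carrier E \<Longrightarrow> y \<in> carrier E \<Longrightarrow> AE w in P. F (x \<oplus>\<^bsub>E\<^esub> y) w = F x w + F y w"
    and "a \<in> borel_measurable P \<Longrightarrow> x \<in> carrier E \<Longrightarrow> AE w in P. F (a \<triangleright> x) w = a w * F x w"
  using assms by (simp_all add: random_linear_def)

text \<open>Totality of \<open>K0\<close> bounds each element from above and, through its negative,
  from below, so that a maximal cone gives it a finite value.\<close>

theorem L0_Hahn_Banach:
  assumes K0: "epi_cone H K0" and total: "\<And>x. x \<in> carrier E \<Longrightarrow> \<exists>h. (x, h) \<in> K0"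
    and H [measurable]: "H \<in> sets P"
  obtains F where "random_linear F"
    and "\<forall>x h. (x, h) \<in> K0 \<longrightarrow> (AE w in P. w \<in> H \<longrightarrow> F x w \<le> h w)"
    and "\<forall>x. \<forall>w. w \<notin> H \<longrightarrow> F x w = 0"
proof -
  obtain K where K: "epi_cone H K" and sub: "K0 \<subseteq> K"
    and max: "\<And>K'. epi_cone H K' \<Longrightarrow> K \<subseteq> K' \<Longrightarrow> K' = K"
    using epi_cone_maximal[OF K0] by blast
  have "\<forall>x\<in>carrier E. \<exists>r. (x, r) \<in> K \<and> (\<ominus>\<^bsub>E\<^esub> x, \<lambda>w. - r w) \<in> K"
    using epi_cone_maximal_graph[OF K max H] total sub by blast
  then obtain R where R: "\<And>x. x \<in> carrier E \<Longrightarrow> (x, R x) \<in> K"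
    "\<And>x. x \<in> carrier E \<Longrightarrow> (\<ominus>\<^bsub>E\<^esub> x, \<lambda>w. - R x w) \<in> K" by metis
  have R_le: "AE w in P. w \<in> H \<longrightarrow> R x w \<le> h w" if "(x, h) \<in> K" for x h
    using epi_cone_opposite[OF K that R(2)] epi_coneD(1)[OF K that] by auto
  \<comment> \<open>The two constraints pin \<open>r\<close> to \<open>R x\<close> on
    \<open>H\<close>. Additivity and homogeneity below are instances of this uniqueness.\<close>
  have R_eq: "AE w in P. w \<in> H \<longrightarrow> R x w = r w"
    if "(x, r) \<in> K" "(\<ominus>\<^bsub>E\<^esub> x, \<lambda>w. - r w) \<in> K" for x r
    using epi_cone_opposite[OF K R(1) that(2)] R_le[OF that(1)] epi_coneD(1)[OF K that(1)] by auto
  have add: "AE w in P. w \<in> H \<longrightarrow> R (x \<oplus>\<^bsub>E\<^esub> y) w = R x w + R y w"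
    if "x \<in> carrier E" "y \<in> carrier E" for x y
    using epi_coneD(3)[OF K R(1)[OF that(1)] R(1)[OF that(2)]]
      epi_coneD(3)[OF K R(2)[OF that(1)] R(2)[OF that(2)]] that
    by (intro R_eq) (auto simp: M.minus_add)
  have smult: "AE w in P. w \<in> H \<longrightarrow> R (a \<triangleright> x) w = a w * R x w"
    if a [measurable]: "a \<in> borel_measurable P" and x: "x \<in> carrier E" for a x
  proof -
    \<comment> \<open>The cone admits only nonnegative multipliers, so \<open>a\<close> is split
      into positive and negative part and the latter is applied to the negative of
      \<open>x\<close>.\<close>
    define p where "p w = max (a w) 0" for w
    define n where "n w = max (- a w) 0" for w
    have [measurable]: "p \<in> borel_measurable P" "n \<in> borel_measurable P"
      unfolding p_def n_def by measurable
    have a_eq: "a = (\<lambda>w. p w + - n w)" by (auto simp: p_def n_def)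
    have ax: "a \<triangleright> x = p \<triangleright> x \<oplus>\<^bsub>E\<^esub> \<ominus>\<^bsub>E\<^esub> (n \<triangleright> x)"
      using x real_smult_add_left[of p "\<lambda>w. - n w" x] by (simp add: a_eq real_smult_minus_left)
    have pn: "0 \<le> p w" "0 \<le> n w" for w by (auto simp: p_def n_def)
    have "(p \<triangleright> x \<oplus>\<^bsub>E\<^esub> n \<triangleright> (\<ominus>\<^bsub>E\<^esub> x), \<lambda>w. p w * R x w + n w * - R x w) \<in> K"
      using R x pn by (intro epi_coneD(3,4)[OF K]) auto
    moreover have "p \<triangleright> x \<oplus>\<^bsub>E\<^esub> n \<triangleright> (\<ominus>\<^bsub>E\<^esub> x) = a \<triangleright> x"
      using x by (simp add: ax real_smult_minus_right)
    moreover have "(\<lambda>w. p w * R x w + n w * - R x w) = (\<lambda>w. a w * R x w)"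
      unfolding a_eq by (simp add: algebra_simps)
    ultimately have 1: "(a \<triangleright> x, \<lambda>w. a w * R x w) \<in> K" by simp
    have "(p \<triangleright> (\<ominus>\<^bsub>E\<^esub> x) \<oplus>\<^bsub>E\<^esub> n \<triangleright> x, \<lambda>w. p w * - R x w + n w * R x w) \<in> K"
      using R x pn by (intro epi_coneD(3,4)[OF K]) auto
    moreover have "p \<triangleright> (\<ominus>\<^bsub>E\<^esub> x) \<oplus>\<^bsub>E\<^esub> n \<triangleright> x = \<ominus>\<^bsub>E\<^esub> (a \<triangleright> x)"
      using x by (simp add: ax real_smult_minus_right M.minus_add)
    moreover have "(\<lambda>w. p w * - R x w + n w * R x w) = (\<lambda>w. - (a w * R x w))"
      unfolding a_eq by (simp add: algebra_simps)
    ultimately have "(\<ominus>\<^bsub>E\<^esub> (a \<triangleright> x), \<lambda>w. - (a w * R x w)) \<in> K" by simp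
    with 1 show ?thesis by (rule R_eq)
  qed
  \<comment> \<open>The constraints determine \<open>R\<close> on \<open>H\<close> alone; cutting to
    0 outside turns the identities on \<open>H\<close> into identities almost everywhere.\<close>
  show thesis
  proof (rule that[of "\<lambda>x w. indicator H w * R x w"])
    have "(\<lambda>w. indicator H w * R x w) \<in> borel_measurable P" if "x \<in> carrier E" for x
      using epi_coneD(2)[OF K R(1)[OF that]] by measurable
    moreover have "AE w in P. indicator H w * R (x \<oplus>\<^bsub>E\<^esub> y) w = indicator H w * R x w + indicator H w * R y w"
      if "x \<in> carrier E" "y \<in> carrier E" for x y
      using add[OF that] by eventually_elim (auto simp: indicator_def)
    moreover have "AE w in P. indicator H w * R (a \<triangleright> x) w = a w * (indicator H w * R x w)"
      if "a \<in> borel_measurable P" "x \<in> carrier E" for a x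
      using smult[OF that] by eventually_elim (auto simp: indicator_def)
    ultimately show "random_linear (\<lambda>x w. indicator H w * R x w)"
      by (simp add: random_linear_def)
    have "AE w in P. w \<in> H \<longrightarrow> indicator H w * R x w \<le> h w" if "(x, h) \<in> K0" for x h
      using R_le[of x h] sub that by auto
    then show "\<forall>x h. (x, h) \<in> K0 \<longrightarrow> (AE w in P. w \<in> H \<longrightarrow> indicator H w * R x w \<le> h w)"
      by blast
  qed auto
qed

subsection \<open>Neighbourhoods and continuity\<close>

text \<open>The lattice supremum \<open>seminorm_sup\<close> of a finite family is replaced by a
  bound on each seminorm; for nonnegative \<open>e\<close> the two agree.\<close>

definition nbhd :: "('e \<Rightarrow> ('w \<Rightarrow> real) set) set \<Rightarrow> ('w \<Rightarrow> real) \<Rightarrow> 'e set" where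
  "nbhd Q e = {y \<in> carrier E. \<forall>n\<in>Q. L0_le P (n y) (L0_class P e)}"

lemma seminormE:
  assumes "n \<in> \<N>" "x \<in> carrier E"
  obtains h where "h \<in> borel_measurable P" "n x = L0_class P h"
proof -
  have "n x \<in> carrier (L0 P)"
    using seminorm[OF assms(1)] assms(2) by (auto simp: L0_seminorm_def L0_plus_def)
  then show thesis by (elim L0_carrierE) (rule that)
qed

lemma seminorm_sup_le_iff:
  assumes "finite Q" "Q \<subseteq> \<N>" "e \<in> borel_measurable P" "\<And>w. 0 \<le> e w" "y \<in> carrier E"
  shows "L0_le P (seminorm_sup P Q y) (L0_class P e) \<longleftrightarrow> y \<in> nbhd Q e"
proof -
  have "(\<lambda>n. n y) ` Q \<subseteq> carrier (L0_plus P)"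
    using assms seminorm by (auto simp: L0_seminorm_def Pi_iff subset_iff)
  then show ?thesis
    using assms L0_sup_le_iff[of "(\<lambda>n. n y) ` Q" P "L0_class P e"]
    by (simp add: seminorm_sup_def nbhd_def L0_plus_carrier_iff)
qed

lemma openin_TcE:
  assumes "openin (Tc P E \<N>) G" "x \<in> G"
  obtains Q e where "finite Q" "Q \<subseteq> \<N>" "e \<in> borel_measurable P" "\<And>w. 0 < e w"
    "\<And>y. y \<in> nbhd Q e \<Longrightarrow> x \<oplus>\<^bsub>E\<^esub> y \<in> G"
proof -
  obtain Q \<epsilon> where Q: "finite Q" "Q \<subseteq> \<N>" "\<epsilon> \<in> L0_pplus P"
    "{x \<oplus>\<^bsub>E\<^esub> y | y. y \<in> carrier E \<and> L0_le P (seminorm_sup P Q y) \<epsilon>} \<subseteq> G"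
    using assms unfolding openin_Tc Tc_open_def by blast
  obtain e where e: "e \<in> borel_measurable P" "\<And>w. 0 < e w" "\<epsilon> = L0_class P e"
    by (rule L0_pplusE[OF Q(3)]) (rule that; blast)
  have "x \<oplus>\<^bsub>E\<^esub> y \<in> G" if y: "y \<in> nbhd Q e" for y
  proof -
    have "y \<in> carrier E" using y by (simp add: nbhd_def)
    then have "L0_le P (seminorm_sup P Q y) \<epsilon>"
      using seminorm_sup_le_iff[of Q e y] y Q e less_imp_le by blast
    with \<open>y \<in> carrier E\<close> show ?thesis using Q(4) by blast
  qed
  then show thesis using that Q e by blast
qed

lemma openin_TcI:
  assumes "G \<subseteq> carrier E"
    and "\<And>x. x \<in> G \<Longrightarrow> \<exists>Q e. finite Q \<and> Q \<subseteq> \<N> \<and> e \<in> borel_measurable P \<and> (\<forall>w. 0 < e w) \<and>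
      (\<forall>y\<in>nbhd Q e. x \<oplus>\<^bsub>E\<^esub> y \<in> G)"
  shows "openin (Tc P E \<N>) G"
  unfolding openin_Tc Tc_open_def
proof (intro conjI ballI)
  fix x assume "x \<in> G"
  from assms(2)[OF this] obtain Q e where
    Q: "finite Q" "Q \<subseteq> \<N>" "e \<in> borel_measurable P" "\<And>w. 0 < e w"
      "\<And>y. y \<in> nbhd Q e \<Longrightarrow> x \<oplus>\<^bsub>E\<^esub> y \<in> G"
    by (elim exE conjE) (rule that; blast)
  have "y \<in> nbhd Q e" if "y \<in> carrier E" "L0_le P (seminorm_sup P Q y) (L0_class P e)" for y
    using seminorm_sup_le_iff[of Q e y] that Q less_imp_le by blast
  then show "\<exists>Q \<epsilon>. finite Q \<and> Q \<subseteq> \<N> \<and> \<epsilon> \<in> L0_pplus P \<and>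
      {x \<oplus>\<^bsub>E\<^esub> y | y. y \<in> carrier E \<and> L0_le P (seminorm_sup P Q y) \<epsilon>} \<subseteq> G"
    using Q L0_pplus_class[OF Q(3,4)] by (intro exI[of _ Q] exI[of _ "L0_class P e"]) auto
qed (fact assms(1))

lemma topspace_Tc: "topspace (Tc P E \<N>) = carrier E"
proof
  show "topspace (Tc P E \<N>) \<subseteq> carrier E"
    using openin_topspace[of "Tc P E \<N>"] by (simp add: openin_Tc Tc_open_def)
  have "openin (Tc P E \<N>) (carrier E)"
    by (rule openin_TcI) (auto simp: nbhd_def intro!: exI[of _ "{}"] exI[of _ "\<lambda>_. 1"])
  then show "carrier E \<subseteq> topspace (Tc P E \<N>)" by (rule openin_subset)
qed

lemma nbhd_mono:
  assumes "Q \<subseteq> \<N>" "e \<in> borel_measurable P" "e' \<in> borel_measurable P" "\<And>w. e w \<le> e' w"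
    and y: "y \<in> nbhd Q e"
  shows "y \<in> nbhd Q e'"
proof -
  have "L0_le P (n y) (L0_class P e')" if n: "n \<in> Q" for n
  proof -
    obtain h where h: "h \<in> borel_measurable P" "n y = L0_class P h"
      using n y assms(1) seminormE[of n y] by (auto simp: nbhd_def)
    then have "AE w in P. h w \<le> e w"
      using n y assms by (auto simp: nbhd_def L0_le_class)
    then have "AE w in P. h w \<le> e' w"
      by eventually_elim (use assms(4) order_trans in blast)
    then show ?thesis using h assms by (simp add: L0_le_class)
  qed
  then show ?thesis using y by (simp add: nbhd_def)
qed

text \<open>The multiplier is \<open>'k\<close>-valued because the complex case multiplies by
  \<open>\<i>\<close>.\<close>

lemma nbhd_smult:
  assumes "Q \<subseteq> \<N>" and [measurable]: "e \<in> borel_measurable P" "\<zeta> \<in> borel_measurable P"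
    and y: "y \<in> nbhd Q e"
  shows "L0_class P \<zeta> \<odot>\<^bsub>E\<^esub> y \<in> nbhd Q (\<lambda>w. norm (\<zeta> w) * e w)"
proof -
  have yE: "y \<in> carrier E" using y by (simp add: nbhd_def)
  have "L0_le P (n (L0_class P \<zeta> \<odot>\<^bsub>E\<^esub> y)) (L0_class P (\<lambda>w. norm (\<zeta> w) * e w))" if n: "n \<in> Q" for n
  proof -
    obtain h where h [measurable]: "h \<in> borel_measurable P" and nh: "n y = L0_class P h"
      using n yE assms(1) seminormE[of n y] by auto
    then have "AE w in P. h w \<le> e w"
      using n y assms by (auto simp: nbhd_def L0_le_class)
    then have "AE w in P. norm (\<zeta> w) * h w \<le> norm (\<zeta> w) * e w"
      by eventually_elim (simp add: mult_left_mono)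
    moreover have "n (L0_class P \<zeta> \<odot>\<^bsub>E\<^esub> y) = L0_abs P (L0_class P \<zeta>) \<otimes>\<^bsub>L0 P\<^esub> n y"
      using seminorm[of n] n assms(1) yE by (auto simp: L0_seminorm_def)
    ultimately show ?thesis
      by (simp add: nh L0_map_class L0_class_mult L0_le_class)
  qed
  then show ?thesis using yE by (simp add: nbhd_def)
qed

lemma nbhd_real_smult:
  assumes "Q \<subseteq> \<N>" "e \<in> borel_measurable P" "a \<in> borel_measurable P" "y \<in> nbhd Q e"
  shows "a \<triangleright> y \<in> nbhd Q (\<lambda>w. \<bar>a w\<bar> * e w)"
  using nbhd_smult[OF assms(1,2) _ assms(4), of "\<lambda>w. of_real (a w)"] assms(3)
  by (simp add: real_smult_def)

lemma nbhd_exists: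
  assumes "finite Q" "Q \<subseteq> \<N>" "y \<in> carrier E"
  obtains h where "h \<in> borel_measurable P" "\<And>w. 0 \<le> h w" "y \<in> nbhd Q h"
proof -
  have "\<exists>h\<in>borel_measurable P. (\<forall>w. 0 \<le> h w) \<and> y \<in> nbhd Q h"
    using assms
  proof (induction Q)
    case empty
    then show ?case by (intro bexI[of _ "\<lambda>_. 0"]) (auto simp: nbhd_def)
  next
    case (insert n Q)
    then obtain h where h [measurable]: "h \<in> borel_measurable P" "\<And>w. 0 \<le> h w" "y \<in> nbhd Q h"
      by auto
    obtain k where k [measurable]: "k \<in> borel_measurable P" "n y = L0_class P k"
      using insert seminormE[of n y] by auto
    define l where "l w = max (h w) (k w)" for w
    have l [measurable]: "l \<in> borel_measurable P" unfolding l_def by measurable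
    have "L0_le P (n y) (L0_class P l)"
      by (simp add: k L0_le_class l_def)
    moreover have "y \<in> nbhd Q l"
      using insert h by (intro nbhd_mono[of Q h l]) (auto simp: l_def)
    moreover have "0 \<le> l w" for w
      using h(2)[of w] by (simp add: l_def)
    ultimately show ?case
      by (intro bexI[of _ l]) (auto simp: nbhd_def)
  qed
  then show thesis using that by blast
qed

lemma nbhd_absorbing:
  assumes Q: "finite Q" "Q \<subseteq> \<N>" and y: "y \<in> carrier E"
    and e [measurable]: "e \<in> borel_measurable P" and e_pos: "\<And>w. 0 < e w"
  obtains d where "d \<in> borel_measurable P" "\<And>w. 0 < d w" "d \<triangleright> y \<in> nbhd Q e"
proof -
  obtain h where h [measurable]: "h \<in> borel_measurable P" and h0: "\<And>w. 0 \<le> h w"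
    and yh: "y \<in> nbhd Q h"
    using nbhd_exists[OF Q y] by blast
  \<comment> \<open>The summand 1 keeps the denominator positive where \<open>h\<close> vanishes,
    and \<open>d * h\<close> still stays below \<open>e\<close>.\<close>
  define d where "d w = e w / (1 + h w)" for w
  have d [measurable]: "d \<in> borel_measurable P" unfolding d_def by measurable
  have d_pos: "0 < d w" for w
    using h0[of w] e_pos[of w] by (simp add: d_def)
  have "\<bar>d w\<bar> * h w \<le> e w" for w
    using h0[of w] e_pos[of w] by (simp add: d_def field_simps)
  then have "d \<triangleright> y \<in> nbhd Q e"
    using Q by (intro nbhd_mono[OF _ _ _ _ nbhd_real_smult[OF _ h d yh]]) auto
  with d d_pos show thesis by (rule that)
qed

text \<open>Homogeneity over all random scalars turns a constant bound on one neighbourhood into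
  smallness on smaller ones, hence by additivity into continuity at every point.\<close>

lemma Tc_dualI:
  assumes closed: "f \<in> carrier E \<rightarrow> carrier (L0 P)"
    and add: "\<And>x y. x \<in> carrier E \<Longrightarrow> y \<in> carrier E \<Longrightarrow> f (x \<oplus>\<^bsub>E\<^esub> y) = f x \<oplus>\<^bsub>L0 P\<^esub> f y"
    and smult: "\<And>\<xi> x. \<xi> \<in> carrier (L0 P) \<Longrightarrow> x \<in> carrier E \<Longrightarrow> f (\<xi> \<odot>\<^bsub>E\<^esub> x) = \<xi> \<odot>\<^bsub>L0 P\<^esub> f x"
    and Q: "finite Q" "Q \<subseteq> \<N>" and e [measurable]: "e \<in> borel_measurable P" and e_pos: "\<And>w. 0 < e w"
    and C: "0 < C" and bound: "\<And>y. y \<in> nbhd Q e \<Longrightarrow> L0_le P (L0_abs P (f y)) (L0_class P (\<lambda>_. C))"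
  shows "f \<in> Tc_dual P E \<N>"
proof -
  \<comment> \<open>The target is itself a random locally convex module, so the neighbourhood lemmas
    apply on that side too.\<close>
  interpret L: random_lc_module P "L0 P :: (_, ('w \<Rightarrow> 'k) set) module" "{L0_abs P}"
    by (rule random_lc_module_L0)
  have "openin (Tc P E \<N>) {x \<in> carrier E. f x \<in> U}"
    if U: "openin (Tc P (L0 P :: (_, ('w \<Rightarrow> 'k) set) module) {L0_abs P}) U" for U
  proof (rule openin_TcI)
    fix x assume "x \<in> {x \<in> carrier E. f x \<in> U}"
    then have x: "x \<in> carrier E" "f x \<in> U" by auto
    obtain Q' e' where "finite Q'" and Q': "Q' \<subseteq> {L0_abs P}"
      and [measurable]: "e' \<in> borel_measurable P" and e'_pos: "\<And>w. 0 < e' w"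
      and sub: "\<And>v. v \<in> L.nbhd Q' e' \<Longrightarrow> f x \<oplus>\<^bsub>L0 P\<^esub> v \<in> U"
      by (rule L.openin_TcE[OF U x(2)]) (rule that; blast)
    \<comment> \<open>Scaling by \<open>a = C / e'\<close> carries \<open>nbhd Q d\<close> into
      \<open>nbhd Q e\<close>; the bound \<open>C\<close> there scales back to
      \<open>e'\<close>.\<close>
    define d where "d w = e w * e' w / C" for w
    have [measurable]: "d \<in> borel_measurable P" unfolding d_def by measurable
    have d_pos: "0 < d w" for w
      using e_pos[of w] e'_pos[of w] C by (simp add: d_def)
    have "x \<oplus>\<^bsub>E\<^esub> y \<in> {x \<in> carrier E. f x \<in> U}" if y: "y \<in> nbhd Q d" for y
    proof -
      have yE: "y \<in> carrier E" using y by (simp add: nbhd_def)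
      define a where "a w = C / e' w" for w
      have [measurable]: "a \<in> borel_measurable P" unfolding a_def by measurable
      have "(\<lambda>w. \<bar>a w\<bar> * d w) = e"
      proof
        fix w show "\<bar>a w\<bar> * d w = e w"
          using e'_pos[of w] C by (simp add: a_def d_def field_simps)
      qed
      then have "a \<triangleright> y \<in> nbhd Q e"
        using nbhd_real_smult[OF Q(2) _ _ y, of a] by simp
      then have 1: "L0_le P (L0_abs P (f (a \<triangleright> y))) (L0_class P (\<lambda>_. C))"
        by (rule bound)
      obtain g where g [measurable]: "g \<in> borel_measurable P" and fy: "f y = L0_class P g"
        using closed yE by (auto elim!: L0_carrierE dest!: funcset_mem)
      have "f (a \<triangleright> y) = L0_class P (\<lambda>w. of_real (a w) * g w)"
        using yE by (simp add: real_smult_def smult fy L0_class_mult)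
      then have "AE w in P. \<bar>a w\<bar> * norm (g w) \<le> C"
        using 1 by (simp add: L0_map_class L0_le_class norm_mult)
      then have "AE w in P. norm (g w) \<le> e' w"
      proof eventually_elim
        case (elim w)
        then show ?case using e'_pos[of w] C by (simp add: a_def field_simps)
      qed
      then have "f y \<in> L.nbhd Q' e'"
        using Q' by (auto simp: L.nbhd_def fy L0_map_class L0_le_class)
      then show ?thesis
        using sub[of "f y"] x yE by (simp add: add)
    qed
    then show "\<exists>Q e. finite Q \<and> Q \<subseteq> \<N> \<and> e \<in> borel_measurable P \<and> (\<forall>w. 0 < e w) \<and>
        (\<forall>y\<in>nbhd Q e. x \<oplus>\<^bsub>E\<^esub> y \<in> {x \<in> carrier E. f x \<in> U})"
      using Q d_pos by (intro exI[of _ Q] exI[of _ d]) auto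
  qed auto
  then have "continuous_map (Tc P E \<N>) (Tc P (L0 P :: (_, ('w \<Rightarrow> 'k) set) module) {L0_abs P}) f"
    using closed by (auto simp: continuous_map_def topspace_Tc L.topspace_Tc)
  then show ?thesis
    using closed add smult by (simp add: Tc_dual_def)
qed

subsection \<open>The stratification\<close>

lemma hd_stratification_sets [measurable]: "hd_stratification P E M G \<in> sets P"
  using is_ess_sup_sets_ess_sup_sets[of "{A \<in> sets P.
    (\<lambda>x. L0_ind P A \<odot>\<^bsub>E\<^esub> x) ` M \<inter> (\<lambda>x. L0_ind P A \<odot>\<^bsub>E\<^esub> x) ` G \<noteq> {}}"]
  by (auto simp: hd_stratification_def is_ess_sup_sets_def)

text \<open>Such an \<open>A\<close> belongs to the family whose essential supremum is removed in
  forming the stratification.\<close>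

lemma hd_stratification_null:
  assumes "A \<in> sets P" "A \<subseteq> hd_stratification P E M G" "x \<in> M" "y \<in> G"
    and eq: "indicator A \<triangleright> x = indicator A \<triangleright> y"
  shows "AE w in P. w \<notin> A"
proof -
  let ?\<A> = "{A \<in> sets P. (\<lambda>x. L0_ind P A \<odot>\<^bsub>E\<^esub> x) ` M \<inter> (\<lambda>x. L0_ind P A \<odot>\<^bsub>E\<^esub> x) ` G \<noteq> {}}"
  have "A \<in> ?\<A>"
    using assms by (auto simp: ind_smult)
  then have "AE w in P. w \<in> A \<longrightarrow> w \<in> ess_sup_sets P ?\<A>"
    using is_ess_sup_sets_ess_sup_sets[of ?\<A>] unfolding is_ess_sup_sets_def by blast
  then show ?thesis
    by eventually_elim (use assms(2) in \<open>auto simp: hd_stratification_def\<close>)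
qed

text \<open>The countably many sets exhausting the essential supremum yield one common formal sum.\<close>

lemma hd_stratification_not_null:
  assumes "M \<subseteq> carrier E" "G \<subseteq> carrier E" and disj: "Ccc P E G \<inter> Ccc P E M = {}"
  shows "\<not> (AE w in P. w \<notin> hd_stratification P E M G)"
proof
  assume null: "AE w in P. w \<notin> hd_stratification P E M G"
  define \<A> where "\<A> = {A \<in> sets P. (\<lambda>x. L0_ind P A \<odot>\<^bsub>E\<^esub> x) ` M \<inter> (\<lambda>x. L0_ind P A \<odot>\<^bsub>E\<^esub> x) ` G \<noteq> {}}"
  have \<A>_sets: "\<A> \<subseteq> sets P" by (auto simp: \<A>_def)
  note S = is_ess_sup_sets_ess_sup_sets[OF \<A>_sets]
  have S_full: "AE w in P. w \<in> ess_sup_sets P \<A>"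
    using null AE_space by eventually_elim (auto simp: hd_stratification_def \<A>_def)
  \<comment> \<open>The measures of unions of countable subfamilies have a supremum, and it is
    attained: \<open>\<D>\<close> collects a sequence of subfamilies approaching it.\<close>
  define B where "B = {\<C>. countable \<C> \<and> \<C> \<subseteq> \<A>}"
  have B_sets: "\<Union>\<C> \<in> sets P" if "\<C> \<in> B" for \<C>
    using that \<A>_sets by (auto simp: B_def)
  have "B \<noteq> {}" by (auto simp: B_def)
  then obtain X :: "nat \<Rightarrow> ennreal" where
    X: "range X \<subseteq> (\<lambda>\<C>. emeasure P (\<Union>\<C>)) ` B" "(SUP \<C>\<in>B. emeasure P (\<Union>\<C>)) = (SUP i. X i)"
    using ennreal_Sup_countable_SUP[of "(\<lambda>\<C>. emeasure P (\<Union>\<C>)) ` B"] by blast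
  then have "\<forall>i. \<exists>\<C>\<in>B. X i = emeasure P (\<Union>\<C>)" by auto
  then obtain \<C> where \<C>: "\<And>i. \<C> i \<in> B" "\<And>i. X i = emeasure P (\<Union>(\<C> i))" by metis
  define \<D> where "\<D> = (\<Union>i. \<C> i)"
  have \<D>: "\<D> \<in> B" using \<C>(1) by (auto simp: \<D>_def B_def)
  note [measurable] = B_sets[OF \<D>]
  have "X i \<le> emeasure P (\<Union>\<D>)" for i
    using \<C> B_sets[OF \<D>] by (auto simp: \<D>_def intro!: emeasure_mono)
  then have sup: "emeasure P (\<Union>\<C>') \<le> emeasure P (\<Union>\<D>)" if "\<C>' \<in> B" for \<C>'
    using that X(2) by (metis (no_types, lifting) SUP_least SUP_upper order_trans)
  \<comment> \<open>If \<open>A\<close> left the union on a set of positive measure, adjoining it to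
    \<open>\<D>\<close> would exceed the supremum.\<close>
  have "AE w in P. w \<in> A \<longrightarrow> w \<in> \<Union>\<D>" if A: "A \<in> \<A>" for A
  proof -
    have [measurable]: "A \<in> sets P" using A \<A>_sets by auto
    have "insert A \<D> \<in> B" using A \<D> by (auto simp: B_def)
    from sup[OF this] have "emeasure P (\<Union>\<D> \<union> (A - \<Union>\<D>)) \<le> emeasure P (\<Union>\<D>)"
      by (simp add: Un_commute)
    then have "prob (\<Union>\<D> \<union> (A - \<Union>\<D>)) \<le> prob (\<Union>\<D>)"
      by (simp add: emeasure_eq_measure)
    moreover have "prob (\<Union>\<D> \<union> (A - \<Union>\<D>)) = prob (\<Union>\<D>) + prob (A - \<Union>\<D>)"
      by (rule finite_measure_Union) auto
    ultimately have "prob (A - \<Union>\<D>) = 0"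
      using measure_nonneg[of P "A - \<Union>\<D>"] by linarith
    then have "AE w in P. w \<notin> A - \<Union>\<D>"
      by (subst (asm) prob_eq_0) auto
    then show ?thesis by eventually_elim auto
  qed
  then have "AE w in P. w \<in> ess_sup_sets P \<A> \<longrightarrow> w \<in> \<Union>\<D>"
    using S B_sets[OF \<D>] unfolding is_ess_sup_sets_def by blast
  with S_full have full: "AE w in P. w \<in> \<Union>\<D>" by eventually_elim auto
  \<comment> \<open>The empty union cannot have full measure in a probability space; so
    \<open>\<D>\<close> can be enumerated by a sequence.\<close>
  have "\<D> \<noteq> {}"
    using full by auto
  moreover have "countable \<D>" using \<D> by (simp add: B_def)
  ultimately obtain a :: "nat \<Rightarrow> 'w set" where a: "\<D> = range a"
    by (metis range_from_nat_into)
  have "\<forall>i. \<exists>x y. x \<in> M \<and> y \<in> G \<and> indicator (a i) \<triangleright> x = indicator (a i) \<triangleright> y"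
  proof
    fix i
    have "a i \<in> \<A>" using \<D> by (auto simp: a B_def)
    then obtain v where "v \<in> (\<lambda>x. indicator (a i) \<triangleright> x) ` M" "v \<in> (\<lambda>x. indicator (a i) \<triangleright> x) ` G"
      by (auto simp: \<A>_def ind_smult)
    then show "\<exists>x y. x \<in> M \<and> y \<in> G \<and> indicator (a i) \<triangleright> x = indicator (a i) \<triangleright> y"
      by auto
  qed
  then obtain x y where xy: "\<And>i. x i \<in> M" "\<And>i. y i \<in> G"
    "\<And>i. indicator (a i) \<triangleright> x i = indicator (a i) \<triangleright> y i" by metis
  have x_closed [simp]: "x i \<in> carrier E" and y_closed [simp]: "y i \<in> carrier E" for i
    using xy assms by auto
  have [measurable]: "a i \<in> sets P" for i using \<D> \<A>_sets by (auto simp: a B_def)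
  \<comment> \<open>The sets \<open>a i\<close> are made disjoint, and the null set they miss goes
    into piece 0, so that the \<open>b i\<close> partition the space exactly.\<close>
  define b where "b i = disjointed a i \<union> (if i = 0 then space P - \<Union>\<D> else {})" for i :: nat
  have b_sets [measurable]: "b i \<in> sets P" for i
    proof -
    have "range (disjointed a) \<subseteq> sets P" by (rule sets.range_disjointed_sets) auto
    then show ?thesis by (auto simp: b_def)
  qed
  have disjointed_D: "disjointed a i \<subseteq> \<Union>\<D>" for i
    using disjointed_subset[of a i] by (auto simp: a)
  have b_disj: "disjoint_family b"
    unfolding disjoint_family_on_def
  proof (intro ballI impI)
    fix m n :: nat assume "m \<noteq> n"
    then have "disjointed a m \<inter> disjointed a n = {}"
      using disjoint_family_disjointed[of a] by (simp add: disjoint_family_on_def)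
    then show "b m \<inter> b n = {}"
      using disjointed_D[of m] disjointed_D[of n] \<open>m \<noteq> n\<close>
      by (cases "m = 0"; cases "n = 0") (auto simp: b_def)
  qed
  have b_UN: "(\<Union>i. b i) = space P"
    using UN_disjointed_eq[of a] sets.sets_into_space[OF B_sets[OF \<D>]]
    by (auto simp: b_def a split: if_splits)
  \<comment> \<open>Up to a null set \<open>b i\<close> lies in \<open>a i\<close>, where the two
    points agree. The set \<open>c\<close> stands for a piece of an arbitrary formal sum, as it
    occurs in \<open>formal_sum_rel\<close>.\<close>
  have eq: "indicator (c \<inter> b i) \<triangleright> x i = indicator (c \<inter> b i) \<triangleright> y i" if [measurable]: "c \<in> sets P" for c i
  proof -
    have "AE w in P. w \<in> b i \<longrightarrow> w \<in> a i"
      using full by eventually_elim (use disjointed_subset[of a i] in \<open>auto simp: b_def split: if_splits\<close>)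
    then have AE: "AE w in P. indicator (c \<inter> b i) w = (indicator (c \<inter> b i) w * indicator (a i) w :: real)"
      by eventually_elim (auto simp: indicator_def)
    have *: "indicator (c \<inter> b i) \<triangleright> z = indicator (c \<inter> b i) \<triangleright> indicator (a i) \<triangleright> z" if "z \<in> carrier E" for z
      using that by (subst real_smult_cong_AE[OF _ _ AE]) (simp_all add: real_smult_real_smult)
    show ?thesis by (subst (1 2) *) (simp_all only: xy(3) x_closed y_closed)
  qed
  have fs: "(b, x) \<in> formal_sums P E" "(b, y) \<in> formal_sums P E"
    using b_disj b_UN by (auto simp: formal_sums_def)
  have "formal_sum_rel P E `` {(b, x)} = formal_sum_rel P E `` {(b, y)}"
    using fs eq by (auto simp: formal_sum_rel_def ind_smult Int_commute formal_sums_def)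
  moreover have "formal_sum_rel P E `` {(b, x)} \<in> Ccc P E M"
    unfolding Ccc_def using fs xy by (intro quotientI) auto
  moreover have "formal_sum_rel P E `` {(b, y)} \<in> Ccc P E G"
    unfolding Ccc_def using fs xy by (intro quotientI) auto
  ultimately show False using disj by auto
qed

subsection \<open>Separation\<close>

text \<open>Dividing by the total weight turns a nonnegative combination into a convex one.\<close>

lemma L0_convex_cone_add:
  assumes G: "L0_convex P E G" and x: "x \<in> G" and y: "y \<in> G"
    and [measurable]: "a \<in> borel_measurable P" "b \<in> borel_measurable P"
    and nonneg: "\<And>w. 0 \<le> a w" "\<And>w. 0 \<le> b w"
  obtains z where "z \<in> G" "(\<lambda>w. a w + b w) \<triangleright> z = a \<triangleright> x \<oplus>\<^bsub>E\<^esub> b \<triangleright> y"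
proof -
  have xyE: "x \<in> carrier E" "y \<in> carrier E"
    using G x y by (auto simp: L0_convex_def)
  \<comment> \<open>where \<open>a + b = 0\<close>, division by zero gives \<open>c = 0\<close>, and the identities below still hold\<close>
  define c where "c w = a w / (a w + b w)" for w
  have [measurable]: "c \<in> borel_measurable P" unfolding c_def by measurable
  have "0 \<le> c w" "c w \<le> 1" for w
    using nonneg[of w] by (auto simp: c_def divide_le_eq_1)
  then have "c \<triangleright> x \<oplus>\<^bsub>E\<^esub> (\<lambda>w. 1 - c w) \<triangleright> y \<in> G"
    using L0_convexD[OF G x y, of c] by simp
  moreover have "(a w + b w) * c w = a w" "(a w + b w) * (1 - c w) = b w" for w
  proof -
    show 1: "(a w + b w) * c w = a w"
      using nonneg[of w] by (cases "a w + b w = 0") (simp_all add: c_def add_nonneg_eq_0_iff)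
    show "(a w + b w) * (1 - c w) = b w"
      by (simp only: right_diff_distrib 1) simp
  qed
  then have "(\<lambda>w. a w + b w) \<triangleright> (c \<triangleright> x \<oplus>\<^bsub>E\<^esub> (\<lambda>w. 1 - c w) \<triangleright> y) = a \<triangleright> x \<oplus>\<^bsub>E\<^esub> b \<triangleright> y"
    using xyE by (simp add: real_smult_add_right real_smult_real_smult)
  ultimately show thesis by (rule that)
qed

text \<open>This cone encodes that \<open>f\<close> is at most \<open>0\<close> on \<open>G - M\<close> and equal to \<open>1\<close> at \<open>z\<close>.\<close>

definition separation_cone :: "'e set \<Rightarrow> 'e set \<Rightarrow> 'e \<Rightarrow> ('e \<times> ('w \<Rightarrow> real)) set" where
  "separation_cone G M z = {(c \<triangleright> (x \<oplus>\<^bsub>E\<^esub> \<ominus>\<^bsub>E\<^esub> y) \<oplus>\<^bsub>E\<^esub> s \<triangleright> z, s) | c x y s.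
     x \<in> G \<and> y \<in> M \<and> c \<in> borel_measurable P \<and> (\<forall>w. 0 \<le> c w) \<and> s \<in> borel_measurable P}"

lemma separation_coneI:
  assumes "x \<in> G" "y \<in> M" "c \<in> borel_measurable P" "\<And>w. 0 \<le> c w" "s \<in> borel_measurable P"
    and "u = c \<triangleright> (x \<oplus>\<^bsub>E\<^esub> \<ominus>\<^bsub>E\<^esub> y) \<oplus>\<^bsub>E\<^esub> s \<triangleright> z"
  shows "(u, s) \<in> separation_cone G M z"
  using assms unfolding separation_cone_def by blast

lemma separation_coneE:
  assumes "(u, s) \<in> separation_cone G M z"
  obtains c x y where "x \<in> G" "y \<in> M" "c \<in> borel_measurable P" "\<forall>w. 0 \<le> c w"
    "s \<in> borel_measurable P" "u = c \<triangleright> (x \<oplus>\<^bsub>E\<^esub> \<ominus>\<^bsub>E\<^esub> y) \<oplus>\<^bsub>E\<^esub> s \<triangleright> z"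
  using assms unfolding separation_cone_def by blast

text \<open>Where \<open>s\<close> is negative, put \<open>t = - s\<close>; the relation rearranges
  to \<open>c x + t x0 = c y + t y0\<close>. Convexity makes each side the multiple by
  \<open>c + t > 0\<close> of one point of its set. Those points agree there, which the
  stratification allows only on a null set.\<close>

lemma separation_cone_consistent:
  assumes M: "L0_convex P E M" and G: "L0_convex P E G" and x0: "x0 \<in> G" and y0: "y0 \<in> M"
    and zero: "(\<zero>\<^bsub>E\<^esub>, s) \<in> separation_cone G M (y0 \<oplus>\<^bsub>E\<^esub> \<ominus>\<^bsub>E\<^esub> x0)"
  shows "AE w in P. w \<in> hd_stratification P E M G \<longrightarrow> 0 \<le> s w"
proof -
  obtain c x y where x: "x \<in> G" and y: "y \<in> M" and [measurable]: "c \<in> borel_measurable P"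
    and c: "\<forall>w. 0 \<le> c w" and [measurable]: "s \<in> borel_measurable P"
    and eq: "\<zero>\<^bsub>E\<^esub> = c \<triangleright> (x \<oplus>\<^bsub>E\<^esub> \<ominus>\<^bsub>E\<^esub> y) \<oplus>\<^bsub>E\<^esub> s \<triangleright> (y0 \<oplus>\<^bsub>E\<^esub> \<ominus>\<^bsub>E\<^esub> x0)"
    using zero by (rule separation_coneE)
  have carr [simp]: "x \<in> carrier E" "y \<in> carrier E" "x0 \<in> carrier E" "y0 \<in> carrier E"
    using M G x y x0 y0 by (auto simp: L0_convex_def)
  define A where "A = {w \<in> space P. w \<in> hd_stratification P E M G \<and> s w < 0}"
  have [measurable]: "A \<in> sets P" unfolding A_def by measurable
  define a where "a w = indicator A w * c w" for w
  define t where "t w = indicator A w * - s w" for w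
  have [measurable]: "a \<in> borel_measurable P" "t \<in> borel_measurable P"
    unfolding a_def t_def by measurable
  have nonneg: "0 \<le> a w" "0 \<le> t w" for w
    using c by (auto simp: a_def t_def A_def indicator_def)
  have "\<zero>\<^bsub>E\<^esub> = indicator A \<triangleright> (c \<triangleright> (x \<oplus>\<^bsub>E\<^esub> \<ominus>\<^bsub>E\<^esub> y) \<oplus>\<^bsub>E\<^esub> s \<triangleright> (y0 \<oplus>\<^bsub>E\<^esub> \<ominus>\<^bsub>E\<^esub> x0))"
    by (simp flip: eq)
  also have "\<dots> = a \<triangleright> (x \<oplus>\<^bsub>E\<^esub> \<ominus>\<^bsub>E\<^esub> y) \<oplus>\<^bsub>E\<^esub> (\<lambda>w. - t w) \<triangleright> (y0 \<oplus>\<^bsub>E\<^esub> \<ominus>\<^bsub>E\<^esub> x0)"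
  proof -
    have "(\<lambda>w. indicator A w * c w) = a" "(\<lambda>w. indicator A w * s w) = (\<lambda>w. - t w)"
      by (auto simp: a_def t_def)
    then show ?thesis
      by (simp add: real_smult_add_right real_smult_real_smult)
  qed
  also have "\<dots> = (a \<triangleright> x \<oplus>\<^bsub>E\<^esub> t \<triangleright> x0) \<oplus>\<^bsub>E\<^esub> \<ominus>\<^bsub>E\<^esub> (a \<triangleright> y \<oplus>\<^bsub>E\<^esub> t \<triangleright> y0)"
    by (simp add: real_smult_add_right real_smult_minus_right real_smult_minus_left
        M.minus_add M.a_ac)
  finally have "\<ominus>\<^bsub>E\<^esub> (\<ominus>\<^bsub>E\<^esub> (a \<triangleright> y \<oplus>\<^bsub>E\<^esub> t \<triangleright> y0)) = a \<triangleright> x \<oplus>\<^bsub>E\<^esub> t \<triangleright> x0"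
    by (intro M.minus_equality) auto
  then have cross: "a \<triangleright> x \<oplus>\<^bsub>E\<^esub> t \<triangleright> x0 = a \<triangleright> y \<oplus>\<^bsub>E\<^esub> t \<triangleright> y0" by simp
  obtain x' where x': "x' \<in> G" "(\<lambda>w. a w + t w) \<triangleright> x' = a \<triangleright> x \<oplus>\<^bsub>E\<^esub> t \<triangleright> x0"
    by (rule L0_convex_cone_add[OF G x x0, of a t]) (use nonneg in auto)
  obtain y' where y': "y' \<in> M" "(\<lambda>w. a w + t w) \<triangleright> y' = a \<triangleright> y \<oplus>\<^bsub>E\<^esub> t \<triangleright> y0"
    by (rule L0_convex_cone_add[OF M y y0, of a t]) (use nonneg in auto)
  have carr' [simp]: "x' \<in> carrier E" "y' \<in> carrier E"
    using M G x' y' by (auto simp: L0_convex_def)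
  \<comment> \<open>On \<open>A\<close> the weight is at least \<open>t > 0\<close> and can be
    inverted; off \<open>A\<close> it is 0. The product is therefore the indicator of
    \<open>A\<close>.\<close>
  define b where "b w = (if a w + t w = 0 then 0 else 1 / (a w + t w))" for w
  have [measurable]: "b \<in> borel_measurable P" unfolding b_def by measurable
  have "b w * (a w + t w) = indicator A w" for w
  proof (cases "w \<in> A")
    case True
    then have "0 < t w" by (auto simp: t_def A_def)
    then show ?thesis using nonneg(1)[of w] True by (simp add: b_def)
  qed (simp add: a_def t_def)
  then have b_ind: "b \<triangleright> (\<lambda>w. a w + t w) \<triangleright> v = indicator A \<triangleright> v" if "v \<in> carrier E" for v
    using that by (simp add: real_smult_real_smult)
  have "indicator A \<triangleright> y' = indicator A \<triangleright> x'"
    using b_ind[of x'] b_ind[of y'] x' y' cross by simp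
  then have "AE w in P. w \<notin> A"
    using x' y' by (intro hd_stratification_null[of A M G y' x']) (auto simp: A_def)
  then show ?thesis
    using AE_space by eventually_elim (auto simp: A_def not_less)
qed

lemma epi_cone_separation_cone:
  assumes M: "L0_convex P E M" and G: "L0_convex P E G" and x0: "x0 \<in> G" and y0: "y0 \<in> M"
  shows "epi_cone (hd_stratification P E M G) (separation_cone G M (y0 \<oplus>\<^bsub>E\<^esub> \<ominus>\<^bsub>E\<^esub> x0))"
proof -
  have carr [simp]: "x \<in> G \<Longrightarrow> x \<in> carrier E" "y \<in> M \<Longrightarrow> y \<in> carrier E" for x y
    using M G by (auto simp: L0_convex_def)
  define z where "z = y0 \<oplus>\<^bsub>E\<^esub> \<ominus>\<^bsub>E\<^esub> x0"
  have [simp]: "z \<in> carrier E" using x0 y0 by (auto simp: z_def)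
  show ?thesis
    unfolding epi_cone_def z_def[symmetric]
  proof (intro conjI allI impI)
    show "separation_cone G M z \<subseteq> carrier E \<times> borel_measurable P"
      by (auto elim!: separation_coneE)
  next
    fix u1 s1 u2 s2
    assume "(u1, s1) \<in> separation_cone G M z" "(u2, s2) \<in> separation_cone G M z"
    then obtain c1 x1 y1 c2 x2 y2 where
      1: "x1 \<in> G" "y1 \<in> M" "c1 \<in> borel_measurable P" "\<forall>w. 0 \<le> c1 w" "s1 \<in> borel_measurable P"
        "u1 = c1 \<triangleright> (x1 \<oplus>\<^bsub>E\<^esub> \<ominus>\<^bsub>E\<^esub> y1) \<oplus>\<^bsub>E\<^esub> s1 \<triangleright> z" and
      2: "x2 \<in> G" "y2 \<in> M" "c2 \<in> borel_measurable P" "\<forall>w. 0 \<le> c2 w" "s2 \<in> borel_measurable P"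
        "u2 = c2 \<triangleright> (x2 \<oplus>\<^bsub>E\<^esub> \<ominus>\<^bsub>E\<^esub> y2) \<oplus>\<^bsub>E\<^esub> s2 \<triangleright> z"
      by (elim separation_coneE)
    note [measurable] = 1(3,5) 2(3,5)
    \<comment> \<open>Using the same weights in \<open>G\<close> and in \<open>M\<close> makes the
      sum of two multiples of differences a single multiple of a difference.\<close>
    obtain x where x: "x \<in> G" "(\<lambda>w. c1 w + c2 w) \<triangleright> x = c1 \<triangleright> x1 \<oplus>\<^bsub>E\<^esub> c2 \<triangleright> x2"
      by (rule L0_convex_cone_add[OF G 1(1) 2(1), of c1 c2]) (use 1 2 in auto)
    obtain y where y: "y \<in> M" "(\<lambda>w. c1 w + c2 w) \<triangleright> y = c1 \<triangleright> y1 \<oplus>\<^bsub>E\<^esub> c2 \<triangleright> y2"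
      by (rule L0_convex_cone_add[OF M 1(2) 2(2), of c1 c2]) (use 1 2 in auto)
    note c = carr(1)[OF 1(1)] carr(1)[OF 2(1)] carr(2)[OF 1(2)] carr(2)[OF 2(2)]
      carr(1)[OF x(1)] carr(2)[OF y(1)]
    have "u1 \<oplus>\<^bsub>E\<^esub> u2 =
        (c1 \<triangleright> x1 \<oplus>\<^bsub>E\<^esub> c2 \<triangleright> x2) \<oplus>\<^bsub>E\<^esub> \<ominus>\<^bsub>E\<^esub> (c1 \<triangleright> y1 \<oplus>\<^bsub>E\<^esub> c2 \<triangleright> y2) \<oplus>\<^bsub>E\<^esub> (\<lambda>w. s1 w + s2 w) \<triangleright> z"
      using c by (simp add: 1(6) 2(6) real_smult_add_right real_smult_add_left
          real_smult_minus_right M.minus_add M.a_ac)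
    also have "\<dots> = (\<lambda>w. c1 w + c2 w) \<triangleright> (x \<oplus>\<^bsub>E\<^esub> \<ominus>\<^bsub>E\<^esub> y) \<oplus>\<^bsub>E\<^esub> (\<lambda>w. s1 w + s2 w) \<triangleright> z"
      using c by (simp add: real_smult_add_right real_smult_minus_right flip: x(2) y(2))
    finally show "(u1 \<oplus>\<^bsub>E\<^esub> u2, \<lambda>w. s1 w + s2 w) \<in> separation_cone G M z"
      using x y 1 2 by (intro separation_coneI[of x G y M "\<lambda>w. c1 w + c2 w"]) auto
  next
    fix a :: "'w \<Rightarrow> real" and u s
    assume a: "a \<in> borel_measurable P" "\<forall>w. 0 \<le> a w" and "(u, s) \<in> separation_cone G M z"
    then obtain c x y where
      1: "x \<in> G" "y \<in> M" "c \<in> borel_measurable P" "\<forall>w. 0 \<le> c w" "s \<in> borel_measurable P"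
        "u = c \<triangleright> (x \<oplus>\<^bsub>E\<^esub> \<ominus>\<^bsub>E\<^esub> y) \<oplus>\<^bsub>E\<^esub> s \<triangleright> z"
      by (elim separation_coneE)
    then show "(a \<triangleright> u, \<lambda>w. a w * s w) \<in> separation_cone G M z"
      using a carr(1)[OF 1(1)] carr(2)[OF 1(2)]
      by (intro separation_coneI[of x G y M "\<lambda>w. a w * c w"])
        (auto simp: real_smult_add_right real_smult_real_smult)
  next
    fix h assume "(\<zero>\<^bsub>E\<^esub>, h) \<in> separation_cone G M z"
    then show "AE w in P. w \<in> hd_stratification P E M G \<longrightarrow> 0 \<le> h w"
      unfolding z_def by (rule separation_cone_consistent[OF assms])
  qed
qed

text \<open>The neighbourhood with its bound 1 is recorded for \<open>Tc_dualI\<close>, so that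
  continuity can be derived afterwards for either scalar field.\<close>

lemma real_separation:
  assumes "M \<noteq> {}" "G \<noteq> {}" and M: "L0_convex P E M" and G: "L0_convex P E G"
    and op: "openin (Tc P E \<N>) G"
  obtains F Q e where "random_linear F"
    and "\<forall>x w. w \<notin> hd_stratification P E M G \<longrightarrow> F x w = 0"
    and "\<forall>x\<in>G. \<forall>y\<in>M. AE w in P. w \<in> hd_stratification P E M G \<longrightarrow> F x w < F y w"
    and "finite Q" "Q \<subseteq> \<N>" "e \<in> borel_measurable P" "\<forall>w. 0 < e w"
    and "\<forall>y\<in>nbhd Q e. AE w in P. \<bar>F y w\<bar> \<le> 1"
proof -
  obtain x0 y0 where x0: "x0 \<in> G" and y0: "y0 \<in> M" using assms by blast
  have carr: "x \<in> G \<Longrightarrow> x \<in> carrier E" "y \<in> M \<Longrightarrow> y \<in> carrier E" for x y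
    using M G by (auto simp: L0_convex_def)
  note [simp] = carr(1)[OF x0] carr(2)[OF y0]
  define H where "H = hd_stratification P E M G"
  have [measurable]: "H \<in> sets P" by (simp add: H_def)
  define z where "z = y0 \<oplus>\<^bsub>E\<^esub> \<ominus>\<^bsub>E\<^esub> x0"
  have [simp]: "z \<in> carrier E" by (simp add: z_def)
  let ?K = "separation_cone G M z"
  have K: "epi_cone H ?K"
    unfolding H_def z_def by (rule epi_cone_separation_cone[OF M G x0 y0])
  obtain Q e where Q: "finite Q" "Q \<subseteq> \<N>" and e [measurable]: "e \<in> borel_measurable P"
    and e_pos: "\<And>w. 0 < e w" and ball: "\<And>y. y \<in> nbhd Q e \<Longrightarrow> x0 \<oplus>\<^bsub>E\<^esub> y \<in> G"
    by (rule openin_TcE[OF op x0]) (rule that; blast)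
  \<comment> \<open>Since \<open>y = (x0 + y - y0) + z\<close>, the constraint by 1 on a
    neighbourhood of the origin is already in the cone.\<close>
  have unit: "(y, \<lambda>_. 1) \<in> ?K" if y: "y \<in> nbhd Q e" for y
  proof (rule separation_coneI[OF ball[OF y] y0])
    have "y \<in> carrier E" using y by (simp add: nbhd_def)
    moreover have "x0 \<oplus>\<^bsub>E\<^esub> y \<oplus>\<^bsub>E\<^esub> \<ominus>\<^bsub>E\<^esub> y0 \<oplus>\<^bsub>E\<^esub> z = y \<oplus>\<^bsub>E\<^esub> ((x0 \<oplus>\<^bsub>E\<^esub> \<ominus>\<^bsub>E\<^esub> x0) \<oplus>\<^bsub>E\<^esub> (y0 \<oplus>\<^bsub>E\<^esub> \<ominus>\<^bsub>E\<^esub> y0))"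
      unfolding z_def using \<open>y \<in> carrier E\<close> by (simp only: M.a_ac M.a_closed M.a_inv_closed carr x0 y0)
    ultimately show "y = (\<lambda>_. 1) \<triangleright> (x0 \<oplus>\<^bsub>E\<^esub> y \<oplus>\<^bsub>E\<^esub> \<ominus>\<^bsub>E\<^esub> y0) \<oplus>\<^bsub>E\<^esub> (\<lambda>_. 1) \<triangleright> z"
      by (simp add: M.r_neg)
  qed auto
  \<comment> \<open>Scale \<open>y\<close> into the neighbourhood by a positive \<open>d\<close>,
    use the bound 1 there, and scale back by \<open>1 / d\<close>.\<close>
  have total: "\<exists>h. (y, h) \<in> ?K" if y: "y \<in> carrier E" for y
  proof -
    obtain d where [measurable]: "d \<in> borel_measurable P" and d: "\<And>w. 0 < d w" "d \<triangleright> y \<in> nbhd Q e"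
      by (rule nbhd_absorbing[OF Q y e e_pos]) (rule that; blast)
    have "((\<lambda>w. 1 / d w) \<triangleright> d \<triangleright> y, \<lambda>w. 1 / d w * 1) \<in> ?K"
      using d by (intro epi_coneD(4)[OF K] unit) (auto simp: less_imp_le)
    moreover have "(\<lambda>w. 1 / d w * d w) = (\<lambda>w. 1)"
      using d(1) by (metis nonzero_eq_divide_eq less_irrefl)
    then have "(\<lambda>w. 1 / d w) \<triangleright> d \<triangleright> y = y"
      using y by (simp add: real_smult_real_smult)
    ultimately show ?thesis by auto
  qed
  obtain F where F: "random_linear F"
    and F_le': "\<forall>x h. (x, h) \<in> ?K \<longrightarrow> (AE w in P. w \<in> H \<longrightarrow> F x w \<le> h w)"
    and F_off: "\<forall>x. \<forall>w. w \<notin> H \<longrightarrow> F x w = 0"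
    by (rule L0_Hahn_Banach[OF K total \<open>H \<in> sets P\<close>], assumption, rule that)
  note F_add = random_linearD(2)[OF F] and F_smult = random_linearD(3)[OF F]
    and F_le = F_le'[rule_format]
  have F_minus: "AE w in P. F (\<ominus>\<^bsub>E\<^esub> x) w = - F x w" if "x \<in> carrier E" for x
    using F_smult[of "\<lambda>_. - 1" x] that by (simp add: real_smult_minus_left)
  have Fz: "AE w in P. w \<in> H \<longrightarrow> 1 \<le> F z w"
  proof -
    \<comment> \<open>Multiplier 0 and \<open>s = - 1\<close> give the constraint
      \<open>- F z \<le> - 1\<close>.\<close>
    have "(\<ominus>\<^bsub>E\<^esub> z, \<lambda>_. - 1) \<in> ?K"
      by (rule separation_coneI[OF x0 y0, of "\<lambda>_. 0"]) (simp_all add: real_smult_minus_left)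
    from F_le[OF this] F_minus[of z] show ?thesis by auto
  qed
  \<comment> \<open>Openness leaves room to move \<open>x\<close> by \<open>d z\<close> inside
    \<open>G\<close>. From \<open>F (x + d z) \<le> F y\<close>, \<open>0 < d\<close> and
    \<open>1 \<le> F z\<close> the inequality for \<open>x\<close> itself becomes strict.\<close>
  have strict: "AE w in P. w \<in> H \<longrightarrow> F x w < F y w" if x: "x \<in> G" and y: "y \<in> M" for x y
  proof -
    have xy [simp]: "x \<in> carrier E" "y \<in> carrier E" using x y carr by auto
    obtain Q' e' where Q': "finite Q'" "Q' \<subseteq> \<N>" and e' [measurable]: "e' \<in> borel_measurable P"
      and e'_pos: "\<And>w. 0 < e' w" and ball': "\<And>v. v \<in> nbhd Q' e' \<Longrightarrow> x \<oplus>\<^bsub>E\<^esub> v \<in> G"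
      by (rule openin_TcE[OF op x]) (rule that; blast)
    obtain d where [measurable]: "d \<in> borel_measurable P" and d: "\<And>w. 0 < d w" "d \<triangleright> z \<in> nbhd Q' e'"
      by (rule nbhd_absorbing[OF Q' \<open>z \<in> carrier E\<close> e' e'_pos]) (rule that; blast)
    have "((x \<oplus>\<^bsub>E\<^esub> d \<triangleright> z) \<oplus>\<^bsub>E\<^esub> \<ominus>\<^bsub>E\<^esub> y, \<lambda>_. 0) \<in> ?K"
      by (rule separation_coneI[OF ball'[OF d(2)] y, of "\<lambda>_. 1"]) simp_all
    from F_le[OF this] F_add[of "x \<oplus>\<^bsub>E\<^esub> d \<triangleright> z" "\<ominus>\<^bsub>E\<^esub> y", simplified] F_add[of x "d \<triangleright> z", simplified]
      F_smult[of d z, simplified] F_minus[of y, simplified] Fz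
    show ?thesis
    proof eventually_elim
      case (elim w)
      have "w \<in> H \<Longrightarrow> 0 < d w * F z w" using elim d(1)[of w] by simp
      then show ?case using elim by auto
    qed
  qed
  have "AE w in P. \<bar>F y w\<bar> \<le> 1" if y: "y \<in> nbhd Q e" for y
  proof -
    have yE: "y \<in> carrier E" using y by (simp add: nbhd_def)
    \<comment> \<open>The neighbourhood is symmetric, so the one-sided bound applies to both signs;
      off \<open>H\<close> the value is 0.\<close>
    have "\<ominus>\<^bsub>E\<^esub> y \<in> nbhd Q e"
      using nbhd_real_smult[OF Q(2) e _ y, of "\<lambda>_. - 1"] yE by (simp add: real_smult_minus_left)
    from F_le[OF unit[OF this]] F_le[OF unit[OF y]] F_minus[OF yE]
    show ?thesis
    proof eventually_elim
      case (elim w)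
      then show ?case using F_off by (cases "w \<in> H") auto
    qed
  qed
  then show thesis
    using F F_off strict Q e e_pos unfolding H_def by (intro that[of F Q e]) auto
qed

text \<open>Equality off the stratification gives the weak inequality everywhere. Equal classes
  would make the stratification null, against \<open>hd_stratification_not_null\<close>.\<close>

lemma L0_less_if_strict_on_stratification:
  assumes "M \<subseteq> carrier E" "G \<subseteq> carrier E" "Ccc P E G \<inter> Ccc P E M = {}"
    and "g \<in> borel_measurable P" "h \<in> borel_measurable P"
    and off: "\<forall>w. w \<notin> hd_stratification P E M G \<longrightarrow> g w = h w"
    and less: "AE w in P. w \<in> hd_stratification P E M G \<longrightarrow> g w < h w"
  shows "L0_less P (L0_class P g) (L0_class P h)"
proof -
  have "AE w in P. g w \<le> h w"
    using less by eventually_elim (metis off less_imp_le order_refl)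
  moreover have "\<not> (AE w in P. g w = h w)"
  proof
    assume "AE w in P. g w = h w"
    with less have "AE w in P. w \<notin> hd_stratification P E M G" by eventually_elim auto
    then show False using hd_stratification_not_null assms(1-3) by blast
  qed
  ultimately show ?thesis
    using assms by (simp add: L0_less_def L0_le_class L0_class_eq)
qed

end

section \<open>Functionals in the dual module, over the reals and over the complex numbers\<close>

lemma separation_real:
  fixes E :: "(('w \<Rightarrow> real) set, 'e, 'm) module_scheme"
  assumes "random_lc_module P E \<N>" and ne: "M \<noteq> {}" "G \<noteq> {}"
    and M: "L0_convex P E M" and G: "L0_convex P E G"
    and op: "openin (Tc P E \<N>) G" and disj: "Ccc P E G \<inter> Ccc P E M = {}"
  shows "\<exists>f\<in>Tc_dual P E \<N>.
     (\<forall>x\<in>G. \<forall>y\<in>M. L0_less_on P (hd_stratification P E M G) (f x) (f y)) \<and>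
     (\<forall>x\<in>G. \<forall>y\<in>M. L0_less P (f x) (f y))"
proof -
  interpret random_lc_module P E \<N> by fact
  have sub: "M \<subseteq> carrier E" "G \<subseteq> carrier E" using M G by (auto simp: L0_convex_def)
  obtain F Q e where F: "random_linear F"
    and off: "\<forall>x w. w \<notin> hd_stratification P E M G \<longrightarrow> F x w = 0"
    and strict: "\<forall>x\<in>G. \<forall>y\<in>M. AE w in P. w \<in> hd_stratification P E M G \<longrightarrow> F x w < F y w"
    and Q: "finite Q" "Q \<subseteq> \<N>" "e \<in> borel_measurable P" "\<forall>w. 0 < e w"
    and bound: "\<forall>y\<in>nbhd Q e. AE w in P. \<bar>F y w\<bar> \<le> 1"
    by (rule real_separation[OF ne M G op]) (rule that)
  note F = random_linearD[OF F]
  have "(\<lambda>x. L0_class P (F x)) \<in> Tc_dual P E \<N>"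
  proof (rule Tc_dualI[OF _ _ _ Q(1-3) Q(4)[rule_format], of _ 1])
    fix \<xi> :: "('w \<Rightarrow> real) set" and x
    assume "\<xi> \<in> carrier (L0 P)" and x: "x \<in> carrier E"
    then obtain a where a: "a \<in> borel_measurable P" "\<xi> = L0_class P a"
      by (elim L0_carrierE)
    \<comment> \<open>Over the reals \<open>of_real\<close> is the identity, so every scalar class
      acts as some \<open>a \<triangleright>\<close>.\<close>
    then have "\<xi> \<odot>\<^bsub>E\<^esub> x = a \<triangleright> x" by (simp add: real_smult_def)
    then show "L0_class P (F (\<xi> \<odot>\<^bsub>E\<^esub> x)) = \<xi> \<odot>\<^bsub>L0 P\<^esub> L0_class P (F x)"
      using a x F(1,3) by (simp add: L0_class_mult L0_class_eq)
  next
    fix y assume y: "y \<in> nbhd Q e"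
    then have "y \<in> carrier E" by (simp add: nbhd_def)
    then show "L0_le P (L0_abs P (L0_class P (F y))) (L0_class P (\<lambda>_. 1))"
      using F(1) bspec[OF bound y] by (simp add: L0_map_class L0_le_class)
  qed (use F(1,2) in \<open>auto simp: L0_class_add L0_class_eq\<close>)
  moreover have "L0_less_on P (hd_stratification P E M G) (L0_class P (F x)) (L0_class P (F y))"
      "L0_less P (L0_class P (F x)) (L0_class P (F y))" if "x \<in> G" "y \<in> M" for x y
  proof -
    have xy: "x \<in> carrier E" "y \<in> carrier E" using that sub by auto
    have less: "AE w in P. w \<in> hd_stratification P E M G \<longrightarrow> F x w < F y w"
      using strict that by blast
    show "L0_less_on P (hd_stratification P E M G) (L0_class P (F x)) (L0_class P (F y))"
      using L0_less_on_class[OF F(1)[OF xy(1)] F(1)[OF xy(2)]] less by blast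
    show "L0_less P (L0_class P (F x)) (L0_class P (F y))"
      by (rule L0_less_if_strict_on_stratification[OF sub disj F(1)[OF xy(1)] F(1)[OF xy(2)] _ less])
        (simp add: off)
  qed
  ultimately show ?thesis
    by (intro bexI[of _ "\<lambda>x. L0_class P (F x)"] conjI ballI)
qed

text \<open>A complex functional is recovered from its real part \<open>F\<close> as \<open>x \<mapsto> F x - \<i> F (\<i> x)\<close>.\<close>

lemma separation_complex:
  fixes E :: "(('w \<Rightarrow> complex) set, 'e, 'm) module_scheme"
  assumes "random_lc_module P E \<N>" and ne: "M \<noteq> {}" "G \<noteq> {}"
    and M: "L0_convex P E M" and G: "L0_convex P E G"
    and op: "openin (Tc P E \<N>) G" and disj: "Ccc P E G \<inter> Ccc P E M = {}"
  shows "\<exists>f\<in>Tc_dual P E \<N>.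
     (\<forall>x\<in>G. \<forall>y\<in>M. L0_less_on P (hd_stratification P E M G) (L0_Re P (f x)) (L0_Re P (f y))) \<and>
     (\<forall>x\<in>G. \<forall>y\<in>M. L0_less P (L0_Re P (f x)) (L0_Re P (f y)))"
proof -
  interpret random_lc_module P E \<N> by fact
  have sub: "M \<subseteq> carrier E" "G \<subseteq> carrier E" using M G by (auto simp: L0_convex_def)
  obtain F Q e where F: "random_linear F"
    and off: "\<forall>x w. w \<notin> hd_stratification P E M G \<longrightarrow> F x w = 0"
    and strict: "\<forall>x\<in>G. \<forall>y\<in>M. AE w in P. w \<in> hd_stratification P E M G \<longrightarrow> F x w < F y w"
    and Q: "finite Q" "Q \<subseteq> \<N>" "e \<in> borel_measurable P" "\<forall>w. 0 < e w"
    and bound: "\<forall>y\<in>nbhd Q e. AE w in P. \<bar>F y w\<bar> \<le> 1"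
    by (rule real_separation[OF ne M G op]) (rule that)
  note F = random_linearD[OF F]
  define I where "I x = L0_class P (\<lambda>_. \<i>) \<odot>\<^bsub>E\<^esub> x" for x
  have I_closed [simp]: "I x \<in> carrier E" if "x \<in> carrier E" for x
    using that by (simp add: I_def)
  note [measurable] = F(1) F(1)[OF I_closed]
  define g where "g x w = complex_of_real (F x w) - \<i> * complex_of_real (F (I x) w)" for x w
  have g_meas [measurable]: "g x \<in> borel_measurable P" if [simp]: "x \<in> carrier E" for x
    unfolding g_def by measurable
  have "(\<lambda>x. L0_class P (g x)) \<in> Tc_dual P E \<N>"
  proof (rule Tc_dualI[OF _ _ _ Q(1-3) Q(4)[rule_format], of _ 2])
    fix x y assume xy: "x \<in> carrier E" "y \<in> carrier E"
    then have "I (x \<oplus>\<^bsub>E\<^esub> y) = I x \<oplus>\<^bsub>E\<^esub> I y" by (simp add: I_def smult_r_distr)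
    then have "AE w in P. g (x \<oplus>\<^bsub>E\<^esub> y) w = g x w + g y w"
      using F(2)[OF xy] F(2)[of "I x" "I y"] xy
      by (auto simp: g_def algebra_simps)
    then show "L0_class P (g (x \<oplus>\<^bsub>E\<^esub> y)) = L0_class P (g x) \<oplus>\<^bsub>L0 P\<^esub> L0_class P (g y)"
      using xy g_meas by (simp add: L0_class_add L0_class_eq)
  next
    fix \<xi> :: "('w \<Rightarrow> complex) set" and x
    assume "\<xi> \<in> carrier (L0 P)" and x: "x \<in> carrier E"
    then obtain a where [measurable]: "a \<in> borel_measurable P" and a: "\<xi> = L0_class P a"
      by (elim L0_carrierE)
    \<comment> \<open>Writing \<open>c = Re c + \<i> Im c\<close> reduces complex multipliers to
      real ones acting on \<open>x\<close> and \<open>I x\<close>.\<close>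
    have smult_eq: "L0_class P c \<odot>\<^bsub>E\<^esub> x = (\<lambda>w. Re (c w)) \<triangleright> x \<oplus>\<^bsub>E\<^esub> (\<lambda>w. Im (c w)) \<triangleright> I x"
      if [measurable]: "c \<in> borel_measurable P" for c
    proof -
      have "c = (\<lambda>w. complex_of_real (Re (c w)) + complex_of_real (Im (c w)) * \<i>)"
        by (auto simp: complex_eq_iff)
      then have "L0_class P c = L0_class P (\<lambda>w. complex_of_real (Re (c w)))
          \<oplus>\<^bsub>L0 P\<^esub> L0_class P (\<lambda>w. complex_of_real (Im (c w))) \<otimes>\<^bsub>L0 P\<^esub> L0_class P (\<lambda>_. \<i>)"
        by (simp add: L0_class_add L0_class_mult)
      then show ?thesis
        using x by (simp add: real_smult_def I_def smult_l_distr smult_assoc1)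
    qed
    have *: "AE w in P. F (L0_class P c \<odot>\<^bsub>E\<^esub> x) w = Re (c w) * F x w + Im (c w) * F (I x) w"
      if [measurable]: "c \<in> borel_measurable P" for c
    proof -
      have "(\<lambda>w. Re (c w)) \<in> borel_measurable P" "(\<lambda>w. Im (c w)) \<in> borel_measurable P" by measurable
      then show ?thesis
        using F(2)[of "(\<lambda>w. Re (c w)) \<triangleright> x" "(\<lambda>w. Im (c w)) \<triangleright> I x"]
          F(3)[of "\<lambda>w. Re (c w)" x] F(3)[of "\<lambda>w. Im (c w)" "I x"] x
        by (auto simp: smult_eq)
    qed
    \<comment> \<open>The formula \<open>*\<close> for \<open>a\<close> gives the real part of the
      homogeneity identity, and for \<open>\<i> * a\<close> the imaginary part.\<close>
    have "I (\<xi> \<odot>\<^bsub>E\<^esub> x) = L0_class P (\<lambda>w. \<i> * a w) \<odot>\<^bsub>E\<^esub> x"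
      using x by (simp add: I_def a L0_class_mult flip: smult_assoc1)
    moreover have "(\<lambda>w. \<i> * a w) \<in> borel_measurable P" by measurable
    ultimately have "AE w in P. g (\<xi> \<odot>\<^bsub>E\<^esub> x) w = a w * g x w"
      using *[of a] *[of "\<lambda>w. \<i> * a w"]
      by (auto simp: g_def a complex_eq_iff algebra_simps)
    then show "L0_class P (g (\<xi> \<odot>\<^bsub>E\<^esub> x)) = \<xi> \<odot>\<^bsub>L0 P\<^esub> L0_class P (g x)"
      using x g_meas by (simp add: a L0_class_mult L0_class_eq)
  next
    fix y assume y: "y \<in> nbhd Q e"
    then have yE: "y \<in> carrier E" by (simp add: nbhd_def)
    \<comment> \<open>Multiplication by \<open>\<i>\<close> preserves the neighbourhood, so both
      real values are bounded by 1, whence the constant 2.\<close>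
    have "I y \<in> nbhd Q e"
      using nbhd_smult[OF Q(2,3) _ y, of "\<lambda>_. \<i>"] by (simp add: I_def)
    from bspec[OF bound y] bspec[OF bound this] have "AE w in P. norm (g y w) \<le> 2"
    proof eventually_elim
      case (elim w)
      have "norm (g y w) \<le> \<bar>F y w\<bar> + \<bar>F (I y) w\<bar>"
        unfolding g_def by (rule order_trans[OF norm_triangle_ineq4]) (simp add: norm_mult)
      with elim show ?case by linarith
    qed
    then show "L0_le P (L0_abs P (L0_class P (g y))) (L0_class P (\<lambda>_. 2))"
      using yE g_meas by (simp add: L0_map_class L0_le_class)
  qed (use g_meas in auto)
  moreover have "L0_Re P (L0_class P (g x)) = L0_class P (F x)" if "x \<in> carrier E" for x
    using that g_meas by (simp add: L0_map_class g_def)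
  moreover have "L0_less_on P (hd_stratification P E M G) (L0_class P (F x)) (L0_class P (F y))"
      "L0_less P (L0_class P (F x)) (L0_class P (F y))" if "x \<in> G" "y \<in> M" for x y
  proof -
    have xy: "x \<in> carrier E" "y \<in> carrier E" using that sub by auto
    have less: "AE w in P. w \<in> hd_stratification P E M G \<longrightarrow> F x w < F y w"
      using strict that by blast
    show "L0_less_on P (hd_stratification P E M G) (L0_class P (F x)) (L0_class P (F y))"
      using L0_less_on_class[OF F(1)[OF xy(1)] F(1)[OF xy(2)]] less by blast
    show "L0_less P (L0_class P (F x)) (L0_class P (F y))"
      by (rule L0_less_if_strict_on_stratification[OF sub disj F(1)[OF xy(1)] F(1)[OF xy(2)] _ less])
        (simp add: off)
  qed
  ultimately show ?thesis
    using sub by (intro bexI[of _ "\<lambda>x. L0_class P (g x)"] conjI ballI) (simp_all add: subset_iff)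
qed

theorem theorem3p22:
  fixes P :: "'w measure"
  shows
    "(\<forall>(E :: (('w \<Rightarrow> real) set, 'e, 'm) module_scheme) \<N> M G.
        random_lc_module P E \<N> \<longrightarrow>
        M \<noteq> {} \<longrightarrow> G \<noteq> {} \<longrightarrow> L0_convex P E M \<longrightarrow> L0_convex P E G \<longrightarrow>
        openin (Tc P E \<N>) G \<longrightarrow> Ccc P E G \<inter> Ccc P E M = {} \<longrightarrow>
        (\<exists>f\<in>Tc_dual P E \<N>.
          (\<forall>x\<in>G. \<forall>y\<in>M. L0_less_on P (hd_stratification P E M G) (f x) (f y)) \<and>
          (\<forall>x\<in>G. \<forall>y\<in>M. L0_less P (f x) (f y))))
     \<and>
     (\<forall>(E :: (('w \<Rightarrow> complex) set, 'd, 'n) module_scheme) \<N> M G.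
        random_lc_module P E \<N> \<longrightarrow>
        M \<noteq> {} \<longrightarrow> G \<noteq> {} \<longrightarrow> L0_convex P E M \<longrightarrow> L0_convex P E G \<longrightarrow>
        openin (Tc P E \<N>) G \<longrightarrow> Ccc P E G \<inter> Ccc P E M = {} \<longrightarrow>
        (\<exists>f\<in>Tc_dual P E \<N>.
          (\<forall>x\<in>G. \<forall>y\<in>M. L0_less_on P (hd_stratification P E M G) (L0_Re P (f x)) (L0_Re P (f y))) \<and>
          (\<forall>x\<in>G. \<forall>y\<in>M. L0_less P (L0_Re P (f x)) (L0_Re P (f y)))))"
  by (intro conjI allI impI separation_real separation_complex)

end
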